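(* Suppose there exist $d,d'\in\mathbb{N}$ and a tensor-stable positive map $P_0:\mathcal{M}_{d}\to\mathcal{M}_{d'}$ that is non-trivial, i.e. neither completely positive nor completely copositive. Then the following assertion is false: "for all $d_1,d_2,d_3\in\mathbb{N}$, every linear map $T:\mathcal{M}_{d_1}\to\mathcal{M}_{d_2}$ that is both completely positive and completely copositive, and every positive map $P:\mathcal{M}_{d_2}\to\mathcal{M}_{d_3}$, the composition $P\circ T$ is decomposable."
   Context: $\mathcal{M}_d$ denotes the complex $d\times d$ matrices; $\vartheta_d$ is the transposition on $\mathcal{M}_d$ in the computational basis. A linear map $L:\mathcal{M}_{d_A}\to\mathcal{M}_{d_B}$ is positive if it maps positive semidefinite matrices to positive semidefinite matrices; completely positive if $\mathrm{id}_k\otimes L$ is positive for all $k\in\mathbb{N}$; completely copositive if $\vartheta_k\otimes L$ is positive for all $k\in\mathbb{N}$; tensor-stable positive if $L^{\otimes n}$ is positive for all $n\in\mathbb{N}$; decomposable if $L=T_1+\vartheta_{d_B}\circ T_2$ for completely positive maps $T_1,T_2:\mathcal{M}_{d_A}\to\mathcal{M}_{d_B}$. (The quoted assertion is an equivalent formulation of the PPT squared conjecture.) *)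

theory Defs
  imports "Jordan_Normal_Form.Matrix" "HOL-Library.Complex_Order"
begin

text \<open>
  The algebra of complex square matrices of size \<open>d\<close> is \<open>carrier_mat d d\<close>. A map between two such
  algebras is a function on \<open>complex mat\<close>, of which only the values on the carrier matter; the
  dimensions of its domain and codomain are passed explicitly.
\<close>

definition linear_map_mat :: "nat \<Rightarrow> nat \<Rightarrow> (complex mat \<Rightarrow> complex mat) \<Rightarrow> bool" where
  "linear_map_mat dA dB L \<longleftrightarrow>
     (\<forall>X \<in> carrier_mat dA dA. L X \<in> carrier_mat dB dB) \<and>
     (\<forall>X \<in> carrier_mat dA dA. \<forall>Y \<in> carrier_mat dA dA. L (X + Y) = L X + L Y) \<and>
     (\<forall>c. \<forall>X \<in> carrier_mat dA dA. L (c \<cdot>\<^sub>m X) = c \<cdot>\<^sub>m L X)"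

text \<open>
  The order on \<open>complex\<close> is the one of \<open>Complex_Order\<close>: \<open>0 \<le> z\<close> says that \<open>z\<close> is real and
  non-negative. The quadratic form below is \<open>v\<^sup>* A v\<close>.
\<close>

definition psd :: "nat \<Rightarrow> complex mat \<Rightarrow> bool" where
  "psd d A \<longleftrightarrow> A \<in> carrier_mat d d \<and> (\<forall>v \<in> carrier_vec d. 0 \<le> (A *\<^sub>v v) \<bullet>c v)"

definition positive_map :: "nat \<Rightarrow> nat \<Rightarrow> (complex mat \<Rightarrow> complex mat) \<Rightarrow> bool" where
  "positive_map dA dB L \<longleftrightarrow> linear_map_mat dA dB L \<and> (\<forall>X. psd dA X \<longrightarrow> psd dB (L X))"

definition kron :: "complex mat \<Rightarrow> complex mat \<Rightarrow> complex mat" where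
  "kron A B = mat (dim_row A * dim_row B) (dim_col A * dim_col B)
     (\<lambda>(r, s). A $$ (r div dim_row B, s div dim_col B) * B $$ (r mod dim_row B, s mod dim_col B))"

definition mat_unit :: "nat \<Rightarrow> nat \<Rightarrow> nat \<Rightarrow> complex mat" where
  "mat_unit d i j = mat d d (\<lambda>p. if p = (i, j) then 1 else 0)"

text \<open>
  The tensor product \<open>L1 \<otimes> L2\<close>, by expanding its argument in the basis of the Kronecker products
  of matrix units: the basis element \<open>kron (mat_unit a1 i j) (mat_unit a2 k l)\<close> has its entry 1 at
  position \<open>(i * a2 + k, j * a2 + l)\<close>. See \<open>tensor_map_kron\<close> for the defining property. The
  expression is linear in \<open>X\<close> whether or not \<open>L1\<close> and \<open>L2\<close> are linear, so the notions
  below that are phrased through tensor products require linearity separately.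
\<close>

definition tensor_map ::
  "nat \<Rightarrow> nat \<Rightarrow> nat \<Rightarrow> nat \<Rightarrow> (complex mat \<Rightarrow> complex mat) \<Rightarrow> (complex mat \<Rightarrow> complex mat)
     \<Rightarrow> complex mat \<Rightarrow> complex mat" where
  "tensor_map a1 b1 a2 b2 L1 L2 X = mat (b1 * b2) (b1 * b2) (\<lambda>(r, s).
     \<Sum>i<a1. \<Sum>j<a1. \<Sum>k<a2. \<Sum>l<a2.
       X $$ (i * a2 + k, j * a2 + l) * kron (L1 (mat_unit a1 i j)) (L2 (mat_unit a2 k l)) $$ (r, s))"

definition completely_positive :: "nat \<Rightarrow> nat \<Rightarrow> (complex mat \<Rightarrow> complex mat) \<Rightarrow> bool" where
  "completely_positive dA dB L \<longleftrightarrow> linear_map_mat dA dB L \<and>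
     (\<forall>k\<ge>1. positive_map (k * dA) (k * dB) (tensor_map k k dA dB id L))"

definition completely_copositive :: "nat \<Rightarrow> nat \<Rightarrow> (complex mat \<Rightarrow> complex mat) \<Rightarrow> bool" where
  "completely_copositive dA dB L \<longleftrightarrow> linear_map_mat dA dB L \<and>
     (\<forall>k\<ge>1. positive_map (k * dA) (k * dB) (tensor_map k k dA dB transpose_mat L))"

text \<open>
  The zeroth tensor power is the identity on 1 by 1 matrices, so that the first one agrees with \<open>L\<close>
  (\<open>tensor_power_1\<close>).
\<close>

fun tensor_power ::
  "nat \<Rightarrow> nat \<Rightarrow> (complex mat \<Rightarrow> complex mat) \<Rightarrow> nat \<Rightarrow> complex mat \<Rightarrow> complex mat" where
  "tensor_power dA dB L 0 = id"
| "tensor_power dA dB L (Suc n) = tensor_map dA dB (dA ^ n) (dB ^ n) L (tensor_power dA dB L n)"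

definition tensor_stable_positive :: "nat \<Rightarrow> nat \<Rightarrow> (complex mat \<Rightarrow> complex mat) \<Rightarrow> bool" where
  "tensor_stable_positive dA dB L \<longleftrightarrow> linear_map_mat dA dB L \<and>
     (\<forall>n\<ge>1. positive_map (dA ^ n) (dB ^ n) (tensor_power dA dB L n))"

definition decomposable :: "nat \<Rightarrow> nat \<Rightarrow> (complex mat \<Rightarrow> complex mat) \<Rightarrow> bool" where
  "decomposable dA dB L \<longleftrightarrow>
     (\<exists>T1 T2. completely_positive dA dB T1 \<and> completely_positive dA dB T2 \<and>
        (\<forall>X \<in> carrier_mat dA dA. L X = T1 X + transpose_mat (T2 X)))"


lemma mat_unit_carrier [simp]: "mat_unit d i j \<in> carrier_mat d d"
  by (simp add: mat_unit_def)

lemma linear_map_mat_zero: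
  assumes "linear_map_mat dA dB L"
  shows "L (0\<^sub>m dA dA) = 0\<^sub>m dB dB"
proof -
  have z: "(0 :: complex) \<cdot>\<^sub>m 0\<^sub>m dA dA = 0\<^sub>m dA dA" by (intro eq_matI) auto
  have c: "L (0\<^sub>m dA dA) \<in> carrier_mat dB dB"
    using assms by (simp add: linear_map_mat_def)
  have "L (0 \<cdot>\<^sub>m 0\<^sub>m dA dA) = 0 \<cdot>\<^sub>m L (0\<^sub>m dA dA)"
    using assms unfolding linear_map_mat_def by (meson zero_carrier_mat)
  also have "\<dots> = 0\<^sub>m dB dB" using c by (intro eq_matI) auto
  finally show ?thesis using z by simp
qed

lemma linear_map_mat_expand:
  assumes L: "linear_map_mat dA dB L" and X: "X \<in> carrier_mat dA dA"
    and rs: "r < dB" "s < dB"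
  shows "L X $$ (r, s) = (\<Sum>i<dA. \<Sum>j<dA. X $$ (i, j) * L (mat_unit dA i j) $$ (r, s))"
proof -
  let ?R = "\<lambda>S. mat dA dA (\<lambda>p. if p \<in> S then X $$ p else 0)"
  have *: "L (?R S) $$ (r, s) = (\<Sum>(i, j)\<in>S. X $$ (i, j) * L (mat_unit dA i j) $$ (r, s))"
    if "finite S" "S \<subseteq> {..<dA} \<times> {..<dA}" for S
    using that
  proof (induction S rule: finite_induct)
    case empty
    have "?R {} = 0\<^sub>m dA dA" by (intro eq_matI) auto
    then show ?case using linear_map_mat_zero[OF L] rs by simp
  next
    case (insert p S)
    obtain i j where p: "p = (i, j)" by (cases p)
    have split: "?R (insert p S) = X $$ p \<cdot>\<^sub>m mat_unit dA i j + ?R S"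
      using insert.hyps p by (intro eq_matI) (auto simp: mat_unit_def)
    have cu: "L (mat_unit dA i j) \<in> carrier_mat dB dB" and cR: "L (?R S) \<in> carrier_mat dB dB"
      using L by (simp_all add: linear_map_mat_def)
    have "L (?R (insert p S)) = X $$ p \<cdot>\<^sub>m L (mat_unit dA i j) + L (?R S)"
      unfolding split using L by (simp add: linear_map_mat_def)
    then have "L (?R (insert p S)) $$ (r, s) = X $$ p * L (mat_unit dA i j) $$ (r, s) + L (?R S) $$ (r, s)"
      using cu cR rs by simp
    with insert p show ?case by simp
  qed
  have "?R ({..<dA} \<times> {..<dA}) = X" using X by (intro eq_matI) auto
  with *[of "{..<dA} \<times> {..<dA}"] show ?thesis
    by (simp add: sum.cartesian_product)
qed

lemma index_pair_less: "i * b + k < a * b" if "i < a" "k < b" for i k a b :: nat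
proof -
  have "i * b + k < Suc i * b" using that by simp
  also have "\<dots> \<le> a * b" using that by (intro mult_right_mono) auto
  finally show ?thesis .
qed

lemma tensor_map_kron:
  assumes L1: "linear_map_mat a1 b1 L1" and L2: "linear_map_mat a2 b2 L2"
    and A: "A \<in> carrier_mat a1 a1" and B: "B \<in> carrier_mat a2 a2"
  shows "tensor_map a1 b1 a2 b2 L1 L2 (kron A B) = kron (L1 A) (L2 B)"
proof -
  have c1: "L1 Y \<in> carrier_mat b1 b1" if "Y \<in> carrier_mat a1 a1" for Y
    using L1 that by (simp add: linear_map_mat_def)
  have c2: "L2 Y \<in> carrier_mat b2 b2" if "Y \<in> carrier_mat a2 a2" for Y
    using L2 that by (simp add: linear_map_mat_def)
  note d1 = carrier_matD[OF c1[OF A]] carrier_matD[OF c1[OF mat_unit_carrier]]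
  note d2 = carrier_matD[OF c2[OF B]] carrier_matD[OF c2[OF mat_unit_carrier]]
  show ?thesis
  proof (rule eq_matI)
    fix r s assume "r < dim_row (kron (L1 A) (L2 B))" "s < dim_col (kron (L1 A) (L2 B))"
    then have rs: "r < b1 * b2" "s < b1 * b2" by (auto simp: kron_def d1 d2)
    then have b2: "b2 > 0" by (cases b2) auto
    have dm: "r div b2 < b1" "s div b2 < b1" "r mod b2 < b2" "s mod b2 < b2"
      using rs b2 by (simp_all add: less_mult_imp_div_less)
    have "tensor_map a1 b1 a2 b2 L1 L2 (kron A B) $$ (r, s) =
      (\<Sum>i<a1. \<Sum>j<a1. \<Sum>k<a2. \<Sum>l<a2. (A $$ (i, j) * B $$ (k, l)) *
        (L1 (mat_unit a1 i j) $$ (r div b2, s div b2) * L2 (mat_unit a2 k l) $$ (r mod b2, s mod b2)))"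
      using rs A B by (simp add: tensor_map_def kron_def d1 d2 index_pair_less)
    also have "\<dots> = (\<Sum>i<a1. \<Sum>j<a1. (A $$ (i, j) * L1 (mat_unit a1 i j) $$ (r div b2, s div b2)) *
       (\<Sum>k<a2. \<Sum>l<a2. B $$ (k, l) * L2 (mat_unit a2 k l) $$ (r mod b2, s mod b2)))"
      by (simp add: sum_distrib_left mult_ac)
    also have "\<dots> = (\<Sum>i<a1. \<Sum>j<a1. A $$ (i, j) * L1 (mat_unit a1 i j) $$ (r div b2, s div b2)) *
       (\<Sum>k<a2. \<Sum>l<a2. B $$ (k, l) * L2 (mat_unit a2 k l) $$ (r mod b2, s mod b2))"
      by (simp only: sum_distrib_right)
    also have "\<dots> = L1 A $$ (r div b2, s div b2) * L2 B $$ (r mod b2, s mod b2)"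
      using linear_map_mat_expand[OF L1 A dm(1,2)] linear_map_mat_expand[OF L2 B dm(3,4)] by simp
    also have "\<dots> = kron (L1 A) (L2 B) $$ (r, s)"
      using rs by (simp add: kron_def d1 d2)
    finally show "tensor_map a1 b1 a2 b2 L1 L2 (kron A B) $$ (r, s) = kron (L1 A) (L2 B) $$ (r, s)" .
  qed (simp_all add: tensor_map_def kron_def d1 d2)
qed

lemma linear_map_mat_tensor_map:
  "linear_map_mat (a1 * a2) (b1 * b2) (tensor_map a1 b1 a2 b2 L1 L2)"
  by (auto simp: linear_map_mat_def tensor_map_def index_pair_less distrib_right sum.distrib
      sum_distrib_left mult.assoc intro!: eq_matI)

lemma tensor_power_1:
  assumes "linear_map_mat dA dB L" and X: "X \<in> carrier_mat dA dA"
  shows "tensor_power dA dB L 1 X = L X"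
proof -
  have "linear_map_mat 1 1 (id :: complex mat \<Rightarrow> complex mat)" by (simp add: linear_map_mat_def)
  note k = tensor_map_kron[OF assms(1) this X one_carrier_mat]
  have one: "kron Y (1\<^sub>m 1) = Y" for Y by (intro eq_matI) (auto simp: kron_def)
  show ?thesis using k by (simp add: one[simplified])
qed

end

theory Submission
  imports Defs "HOL-Analysis.Convex"
begin

text \<open>
  A map is studied through its Choi kernel \<open>C ((i, r), (j, s)) = L (E\<^bsub>ij\<^esub>) (r, s)\<close>. If \<open>C\<^sub>1\<close> is negative at
  a unit vector \<open>\<psi>\<close> and the partial transpose of \<open>C\<^sub>2\<close> is negative at a unit vector \<open>\<phi>\<close>, let
  \<open>W = I - \<psi>\<psi>\<^sup>*\<close>, let \<open>G\<close> be the partial transpose of \<open>\<phi>\<phi>\<^sup>*\<close>, and put \<open>\<rho> = I + G \<otimes> W\<^bsup>\<otimes>k\<^esup>\<close>. Both \<open>\<rho>\<close> and its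
  partial transpose are positive, while \<open>tr ((C\<^sub>2 \<otimes> C\<^sub>1\<^bsup>\<otimes>k\<^esup>) \<rho>)\<close> has the form \<open>c\<^sub>2 c\<^sub>1\<^sup>k + e (c\<^sub>1 - c)\<^sup>k\<close> with
  \<open>c, e < 0 \<le> c\<^sub>1\<close> and is negative for large \<open>k\<close>. A decomposable map pairs non-negatively with such \<open>\<rho>\<close>.

  With \<open>C\<^sub>1 = C\<^sub>2\<close> the Choi kernel of \<open>P\<^sub>0\<close>, the witness \<open>\<rho>\<close> is, up to transposition and
  exchange of the two tensor factors, the Choi kernel of a completely positive and completely copositive \<open>T\<close> such that \<open>R \<circ> T\<close> is not completely positive, where \<open>R = P\<^sub>0\<^bsup>\<otimes>k+1\<^esup>\<close>. The
  same argument for \<open>R \<circ> T\<close> and \<open>R \<circ> T \<circ> \<vartheta>\<close> shows that \<open>R\<^bsup>\<otimes>m+1\<^esup> \<circ> ((T \<circ> \<vartheta>) \<otimes> T\<^bsup>\<otimes>m\<^esup>)\<close> is not decomposable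
  for large \<open>m\<close>. The first factor is positive by tensor stability and the second is completely
  positive and completely copositive.
\<close>

section \<open>Positive semidefinite kernels\<close>

definition quad_form :: "'a set \<Rightarrow> ('a \<Rightarrow> 'a \<Rightarrow> complex) \<Rightarrow> ('a \<Rightarrow> complex) \<Rightarrow> complex" where
  "quad_form S K v = (\<Sum>x\<in>S. \<Sum>y\<in>S. cnj (v x) * K x y * v y)"

text \<open>Kernels live on an arbitrary index type, so that Choi matrices can be indexed by pairs
  instead of encoded numbers. The order on \<open>complex\<close> makes the condition include that
  the form is real.\<close>

definition psd_kernel :: "'a set \<Rightarrow> ('a \<Rightarrow> 'a \<Rightarrow> complex) \<Rightarrow> bool" where
  "psd_kernel S K \<longleftrightarrow> (\<forall>v. 0 \<le> quad_form S K v)"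

lemma psd_kernel_cong:
  assumes "\<And>x y. x \<in> S \<Longrightarrow> y \<in> S \<Longrightarrow> K x y = K' x y"
  shows "psd_kernel S K \<longleftrightarrow> psd_kernel S K'"
  by (simp add: psd_kernel_def quad_form_def assms)

lemma quad_form_cong:
  assumes "\<And>x. x \<in> S \<Longrightarrow> v x = w x"
  shows "quad_form S K v = quad_form S K w"
  by (simp add: quad_form_def assms)

lemma quad_form_mono_neutral:
  assumes "finite S" "U \<subseteq> S" "\<And>x. x \<in> S - U \<Longrightarrow> v x = 0"
  shows "quad_form S K v = quad_form U K v"
proof -
  have "(\<Sum>x\<in>S. \<Sum>y\<in>S. cnj (v x) * K x y * v y) = (\<Sum>x\<in>S. \<Sum>y\<in>U. cnj (v x) * K x y * v y)"
    using assms by (intro sum.cong sum.mono_neutral_right) auto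
  also have "\<dots> = (\<Sum>x\<in>U. \<Sum>y\<in>U. cnj (v x) * K x y * v y)"
    using assms by (intro sum.mono_neutral_right) auto
  finally show ?thesis by (simp add: quad_form_def)
qed

lemma psd_kernel_subset:
  assumes "psd_kernel S K" "finite S" "U \<subseteq> S"
  shows "psd_kernel U K"
  unfolding psd_kernel_def
proof
  fix v :: "'a \<Rightarrow> complex"
  let ?w = "\<lambda>x. if x \<in> U then v x else 0"
  have "quad_form U K v = quad_form U K ?w" by (rule quad_form_cong) simp
  also have "\<dots> = quad_form S K ?w"
    using assms by (intro quad_form_mono_neutral[symmetric]) auto
  finally show "0 \<le> quad_form U K v" using assms(1) by (simp add: psd_kernel_def)
qed

lemma psd_kernel_diag:
  assumes "psd_kernel S K" "finite S" "x \<in> S"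
  shows "0 \<le> K x x"
proof -
  have "psd_kernel {x} K" using assms by (simp add: psd_kernel_subset[of S K])
  then have "0 \<le> quad_form {x} K (\<lambda>_. 1)" unfolding psd_kernel_def by blast
  then show ?thesis by (simp add: quad_form_def)
qed

lemma psd_kernel_two:
  assumes "psd_kernel S K" "finite S" "x \<in> S" "y \<in> S" "x \<noteq> y"
  shows "0 \<le> cnj s * K x x * s + cnj s * K x y * t + (cnj t * K y x * s + cnj t * K y y * t)"
proof -
  have "psd_kernel {x, y} K" using assms by (simp add: psd_kernel_subset[of S K])
  then have "0 \<le> quad_form {x, y} K (\<lambda>z. if z = x then s else t)"
    unfolding psd_kernel_def by blast
  then show ?thesis using assms(5) by (simp add: quad_form_def)
qed

text \<open>The form is real at every vector. Testing it on the pair \<open>x, y\<close> at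
  \<open>(1, 1)\<close> makes the imaginary parts of the off-diagonal entries opposite, and testing
  it at \<open>(1, \<i>)\<close> makes the real parts equal.\<close>

lemma psd_kernel_hermitian:
  assumes "psd_kernel S K" "finite S" "x \<in> S" "y \<in> S"
  shows "K y x = cnj (K x y)"
proof (cases "x = y")
  case True
  then show ?thesis
    using psd_kernel_diag[OF assms(1-3)] by (simp add: complex_eq_iff less_eq_complex_def)
next
  case False
  have "Im (K x x) = 0" "Im (K y y) = 0"
    using psd_kernel_diag[OF assms(1,2)] assms(3,4) by (simp_all add: less_eq_complex_def)
  moreover have "Im (K x x + K x y + (K y x + K y y)) = 0"
    using psd_kernel_two[OF assms False, of 1 1] by (simp add: less_eq_complex_def)
  moreover have "Im (K x x + K x y * \<i> + (- \<i> * K y x + K y y)) = 0"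
    using psd_kernel_two[OF assms False, of 1 \<i>] by (simp add: less_eq_complex_def)
  ultimately show ?thesis by (simp add: complex_eq_iff)
qed

lemma quad_form_hermitian_real:
  assumes "\<And>x y. x \<in> S \<Longrightarrow> y \<in> S \<Longrightarrow> K y x = cnj (K x y)"
  shows "Im (quad_form S K v) = 0"
proof -
  have "cnj (quad_form S K v) = (\<Sum>x\<in>S. \<Sum>y\<in>S. cnj (v y) * K y x * v x)"
    unfolding quad_form_def cnj_sum by (intro sum.cong refl) (simp add: assms[symmetric])
  also have "\<dots> = quad_form S K v"
    unfolding quad_form_def by (rule sum.swap)
  finally show ?thesis by (simp add: complex_eq_iff)
qed

lemma psd_kernelI:
  assumes "\<And>x y. x \<in> S \<Longrightarrow> y \<in> S \<Longrightarrow> K y x = cnj (K x y)"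
    and "\<And>v. 0 \<le> Re (quad_form S K v)"
  shows "psd_kernel S K"
proof -
  have "Im (quad_form S K v) = 0" for v
    by (rule quad_form_hermitian_real) (rule assms(1))
  with assms(2) show ?thesis by (simp add: psd_kernel_def less_eq_complex_def)
qed

section \<open>Elimination of a point and Gram factorization\<close>

lemma psd_kernel_zero_diag:
  assumes "psd_kernel S K" "finite S" "x \<in> S" "y \<in> S" "K x x = 0"
  shows "K x y = 0"
proof (rule ccontr)
  assume nz: "K x y \<noteq> 0"
  then have ne: "x \<noteq> y" using assms by auto
  define n where "n = (cmod (K x y))\<^sup>2"
  \<comment> \<open>With entry \<open>- t * K x y\<close> at \<open>x\<close> and entry 1 at
    \<open>y\<close> the form is \<open>K y y - 2 * t * n\<close>; this \<open>t\<close> turns it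
    into \<open>- K y y - 2\<close>, which is negative.\<close>
  define t where "t = (Re (K y y) + 1) / n"
  have n: "n > 0" using nz by (simp add: n_def)
  have kk: "K x y * cnj (K x y) = complex_of_real n"
    unfolding n_def by (metis complex_norm_square)
  have "0 \<le> K y y" by (rule psd_kernel_diag[OF assms(1,2,4)])
  then have t: "t > 0" using n by (simp add: t_def less_eq_complex_def)
  define s where "s = - of_real t * K x y"
  have "0 \<le> cnj s * K x x * s + cnj s * K x y * 1 + (cnj 1 * K y x * s + cnj 1 * K y y * 1)"
    by (rule psd_kernel_two[OF assms(1-4) ne])
  also have "\<dots> = - 2 * of_real t * (K x y * cnj (K x y)) + K y y"
    unfolding s_def assms(5) psd_kernel_hermitian[OF assms(1-4)] by (simp add: algebra_simps)
  finally have "0 \<le> - 2 * t * n + Re (K y y)" unfolding kk by (simp add: less_eq_complex_def)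
  moreover have "t * n = Re (K y y) + 1" using n by (simp add: t_def)
  ultimately show False using \<open>0 \<le> K y y\<close> by (simp add: less_eq_complex_def)
qed

text \<open>Cholesky elimination of the point \<open>a\<close>; for \<open>K a a = 0\<close> the division by zero leaves \<open>K\<close>
  unchanged, as it should, since then \<open>K a\<close> vanishes.\<close>
lemma psd_kernel_schur_complement:
  assumes "psd_kernel (insert a S) K" "finite S" "a \<notin> S"
  shows "psd_kernel S (\<lambda>x y. K x y - K x a * K a y / K a a)"
  unfolding psd_kernel_def
proof
  fix v :: "'a \<Rightarrow> complex"
  define z where "z = (\<Sum>y\<in>S. K a y * v y)"
  define z' where "z' = (\<Sum>x\<in>S. cnj (v x) * K x a)"
  have herm: "K y x = cnj (K x y)" if "x \<in> insert a S" "y \<in> insert a S" for x y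
    using psd_kernel_hermitian[OF assms(1)] assms(2) that by blast
  have z': "z' = cnj z"
    unfolding z_def z'_def cnj_sum by (intro sum.cong) (simp_all add: herm[of a])
  have aa: "cnj (K a a) = K a a" using herm[of a a] by simp
  \<comment> \<open>Completing the square: for \<open>K a a > 0\<close> this value at
    \<open>a\<close> minimizes the form of \<open>K\<close> among all extensions of
    \<open>v\<close>; for \<open>K a a = 0\<close> it is 0.\<close>
  define w where "w = (\<lambda>x. if x = a then - z / K a a else v x)"
  have w: "w x = v x" if "x \<in> S" for x using that assms(3) by (auto simp: w_def)
  have wa: "w a = - z / K a a" by (simp add: w_def)
  have "quad_form (insert a S) K w = cnj (w a) * K a a * w a + cnj (w a) * z + z' * w a + quad_form S K v"
    unfolding quad_form_def using assms(2,3)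
    by (simp add: w sum.distrib z_def z'_def sum_distrib_left sum_distrib_right mult.assoc)
  also have "\<dots> = quad_form S K v - z' * z / K a a"
    unfolding wa z' by (cases "K a a = 0") (simp_all add: aa)
  also have "z' * z / K a a = (\<Sum>x\<in>S. \<Sum>y\<in>S. cnj (v x) * (K x a * K a y / K a a) * v y)"
    unfolding z_def z'_def sum_product by (simp add: sum_divide_distrib algebra_simps)
  also have "quad_form S K v - \<dots> = quad_form S (\<lambda>x y. K x y - K x a * K a y / K a a) v"
    by (simp add: quad_form_def algebra_simps sum_subtractf)
  finally show "0 \<le> quad_form S (\<lambda>x y. K x y - K x a * K a y / K a a) v"
    using assms(1) unfolding psd_kernel_def by metis
qed

text \<open>Induction on the index set. One rank-one kernel carries the whole row and column of
  \<open>a\<close>; what remains on \<open>S\<close> is the Schur complement, whose Gram factors are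
  extended by 0 to \<open>a\<close>.\<close>

lemma psd_kernel_gram:
  assumes "finite S" "psd_kernel S K"
  obtains g where "\<And>x y. x \<in> S \<Longrightarrow> y \<in> S \<Longrightarrow> K x y = (\<Sum>z\<in>S. g z x * cnj (g z y))"
proof -
  have "\<exists>g. \<forall>x\<in>S. \<forall>y\<in>S. K x y = (\<Sum>z\<in>S. g z x * cnj (g z y))"
    using assms
  proof (induction S arbitrary: K rule: finite_induct)
    case (insert a S)
    let ?K = "\<lambda>x y. K x y - K x a * K a y / K a a"
    obtain g where g: "\<And>x y. x \<in> S \<Longrightarrow> y \<in> S \<Longrightarrow> ?K x y = (\<Sum>z\<in>S. g z x * cnj (g z y))"
      using insert.IH[of ?K] psd_kernel_schur_complement[OF insert.prems insert.hyps(1,2)] by blast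
    have fin: "finite (insert a S)" using insert.hyps by simp
    note herm = psd_kernel_hermitian[OF insert.prems fin]
    have nn: "0 \<le> K a a" using psd_kernel_diag[OF insert.prems fin, of a] by simp
    define r where "r = complex_of_real (sqrt (Re (K a a)))"
    have r: "r * r = K a a" "cnj r = r" using nn
      by (auto simp: r_def complex_eq_iff less_eq_complex_def simp flip: of_real_mult)
    define h where "h = (\<lambda>z x. if z = a then K x a / r else if x = a then 0 else g z x)"
    have h: "h a x = K x a / r" "z \<in> S \<Longrightarrow> h z a = 0"
      "z \<in> S \<Longrightarrow> x \<in> S \<Longrightarrow> h z x = g z x" for x z using insert.hyps(2) by (auto simp: h_def)
    have ha: "h a x * cnj (h a y) = K x a * K a y / K a a" if "x \<in> insert a S" "y \<in> insert a S" for x y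
      using that by (simp add: h r herm[of y a])
    \<comment> \<open>If \<open>K a a = 0\<close>, the quotients are 0 by the convention for
      division, and \<open>K x a\<close> and \<open>K a x\<close> are 0 by positivity.\<close>
    have z0: "K x a * K a a / K a a = K x a" "K a a * K a x / K a a = K a x" if "x \<in> insert a S" for x
      using psd_kernel_zero_diag[OF insert.prems fin, of a x] herm[of a x] that
      by (cases "K a a = 0"; simp)+
    have "K x y = (\<Sum>z\<in>insert a S. h z x * cnj (h z y))" if "x \<in> insert a S" "y \<in> insert a S" for x y
    proof -
      have "(\<Sum>z\<in>insert a S. h z x * cnj (h z y)) = K x a * K a y / K a a + (\<Sum>z\<in>S. h z x * cnj (h z y))"
        using insert.hyps ha that by simp
      also have "\<dots> = K x y"
      proof (cases "x = a \<or> y = a")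
        case True
        then have "(\<Sum>z\<in>S. h z x * cnj (h z y)) = 0" by (intro sum.neutral) (auto simp: h)
        then show ?thesis using True z0 that by auto
      next
        case False
        then have "(\<Sum>z\<in>S. h z x * cnj (h z y)) = ?K x y"
          using that g by (simp add: h)
        then show ?thesis by simp
      qed
      finally show ?thesis by simp
    qed
    then show ?case by blast
  qed simp
  then show thesis using that by blast
qed

section \<open>Closure properties: sums, Schur products, pullbacks, contraction\<close>

lemma quad_form_rank_one:
  "quad_form S (\<lambda>x y. f x * cnj (f y)) v = (\<Sum>x\<in>S. cnj (v x) * f x) * cnj (\<Sum>x\<in>S. cnj (v x) * f x)"
  by (simp add: quad_form_def sum_product algebra_simps)

lemma quad_form_sum:
  "quad_form S (\<lambda>x y. \<Sum>z\<in>Z. K z x y) v = (\<Sum>z\<in>Z. quad_form S (K z) v)"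
proof -
  have "quad_form S (\<lambda>x y. \<Sum>z\<in>Z. K z x y) v = (\<Sum>x\<in>S. \<Sum>y\<in>S. \<Sum>z\<in>Z. cnj (v x) * K z x y * v y)"
    by (simp add: quad_form_def sum_distrib_left sum_distrib_right)
  also have "\<dots> = (\<Sum>x\<in>S. \<Sum>z\<in>Z. \<Sum>y\<in>S. cnj (v x) * K z x y * v y)"
    by (intro sum.cong refl sum.swap)
  also have "\<dots> = (\<Sum>z\<in>Z. quad_form S (K z) v)"
    unfolding quad_form_def by (rule sum.swap)
  finally show ?thesis .
qed

lemma mult_cnj_nonneg: "0 \<le> z * cnj (z :: complex)"
  by (simp add: less_eq_complex_def)

lemma psd_kernel_rank_one: "psd_kernel S (\<lambda>x y. f x * cnj (f y))"
  by (simp only: psd_kernel_def quad_form_rank_one mult_cnj_nonneg simp_thms)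

lemma psd_kernel_sum:
  assumes "\<And>z. z \<in> Z \<Longrightarrow> psd_kernel S (K z)"
  shows "psd_kernel S (\<lambda>x y. \<Sum>z\<in>Z. K z x y)"
  using assms by (simp add: psd_kernel_def quad_form_sum sum_nonneg)

lemma psd_kernel_add:
  assumes "psd_kernel S K" "psd_kernel S K'"
  shows "psd_kernel S (\<lambda>x y. K x y + K' x y)"
proof -
  have "quad_form S (\<lambda>x y. K x y + K' x y) v = quad_form S K v + quad_form S K' v" for v
    by (simp add: quad_form_def algebra_simps sum.distrib)
  then show ?thesis using assms by (simp add: psd_kernel_def)
qed

text \<open>Schur product theorem: pairwise products of the Gram factors of the two kernels are Gram
  factors of the entrywise product.\<close>

lemma psd_kernel_schur_product:
  assumes "finite S" "psd_kernel S K" "psd_kernel S K'"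
  shows "psd_kernel S (\<lambda>x y. K x y * K' x y)"
proof -
  obtain g where g: "\<And>x y. x \<in> S \<Longrightarrow> y \<in> S \<Longrightarrow> K x y = (\<Sum>z\<in>S. g z x * cnj (g z y))"
    using psd_kernel_gram[OF assms(1,2)] by blast
  obtain g' where g': "\<And>x y. x \<in> S \<Longrightarrow> y \<in> S \<Longrightarrow> K' x y = (\<Sum>z\<in>S. g' z x * cnj (g' z y))"
    using psd_kernel_gram[OF assms(1,3)] by blast
  have "psd_kernel S (\<lambda>x y. \<Sum>z\<in>S. \<Sum>z'\<in>S. (g z x * g' z' x) * cnj (g z y * g' z' y))"
    by (intro psd_kernel_sum psd_kernel_rank_one)
  also have "?this \<longleftrightarrow> ?thesis"
    by (intro psd_kernel_cong, simp add: g g' sum_product) (simp add: mult_ac)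
  finally show ?thesis .
qed

text \<open>Gram factors compose with \<open>h\<close>, which covers maps \<open>h\<close> that
  identify points.\<close>

lemma psd_kernel_pullback:
  assumes "finite S" "psd_kernel S K" "\<And>x. x \<in> U \<Longrightarrow> h x \<in> S"
  shows "psd_kernel U (\<lambda>x y. K (h x) (h y))"
proof -
  obtain g where g: "\<And>x y. x \<in> S \<Longrightarrow> y \<in> S \<Longrightarrow> K x y = (\<Sum>z\<in>S. g z x * cnj (g z y))"
    using psd_kernel_gram[OF assms(1,2)] by blast
  have "psd_kernel U (\<lambda>x y. \<Sum>z\<in>S. g z (h x) * cnj (g z (h y)))"
    by (intro psd_kernel_sum psd_kernel_rank_one)
  also have "?this \<longleftrightarrow> ?thesis"
    using assms(3) by (intro psd_kernel_cong) (simp add: g)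
  finally show ?thesis .
qed

lemma psd_kernel_pullback_product:
  assumes "finite U" "finite S" "finite S'" "psd_kernel S K" "psd_kernel S' K'"
    and "\<And>x. x \<in> U \<Longrightarrow> h x \<in> S" "\<And>x. x \<in> U \<Longrightarrow> h' x \<in> S'"
  shows "psd_kernel U (\<lambda>x y. K (h x) (h y) * K' (h' x) (h' y))"
  by (rule psd_kernel_schur_product[OF assms(1) psd_kernel_pullback[OF assms(2,4,6)]
        psd_kernel_pullback[OF assms(3,5,7)]])

lemma psd_kernel_transpose:
  assumes "psd_kernel S K"
  shows "psd_kernel S (\<lambda>x y. K y x)"
  unfolding psd_kernel_def
proof
  fix v :: "'a \<Rightarrow> complex"
  have "quad_form S (\<lambda>x y. K y x) v = quad_form S K (\<lambda>x. cnj (v x))"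
    unfolding quad_form_def by (subst sum.swap) (simp add: algebra_simps)
  then show "0 \<le> quad_form S (\<lambda>x y. K y x) v" using assms by (simp add: psd_kernel_def)
qed

text \<open>The contracted form at \<open>v\<close> is the original form at the vector that equals
  \<open>v\<close> in the first index and is constant in the second.\<close>

lemma psd_kernel_contract:
  assumes "psd_kernel (S \<times> I) (\<lambda>x y. K (fst x) (snd x) (fst y) (snd y))"
  shows "psd_kernel S (\<lambda>r s. \<Sum>i\<in>I. \<Sum>j\<in>I. K r i s j)"
  unfolding psd_kernel_def
proof
  fix v :: "'a \<Rightarrow> complex"
  have "quad_form S (\<lambda>r s. \<Sum>i\<in>I. \<Sum>j\<in>I. K r i s j) v
      = (\<Sum>r\<in>S. \<Sum>s\<in>S. \<Sum>i\<in>I. \<Sum>j\<in>I. cnj (v r) * K r i s j * v s)"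
    by (simp add: quad_form_def sum_distrib_left sum_distrib_right)
  also have "\<dots> = (\<Sum>r\<in>S. \<Sum>i\<in>I. \<Sum>s\<in>S. \<Sum>j\<in>I. cnj (v r) * K r i s j * v s)"
    by (intro sum.cong refl sum.swap)
  also have "\<dots> = quad_form (S \<times> I) (\<lambda>x y. K (fst x) (snd x) (fst y) (snd y)) (\<lambda>x. v (fst x))"
    by (simp add: quad_form_def sum.cartesian_product')
  finally show "0 \<le> quad_form S (\<lambda>r s. \<Sum>i\<in>I. \<Sum>j\<in>I. K r i s j) v"
    using assms by (simp add: psd_kernel_def)
qed

section \<open>The trace pairing \<open>tr (A B)\<close> and the identity kernel\<close>

definition pairing :: "'a set \<Rightarrow> ('a \<Rightarrow> 'a \<Rightarrow> complex) \<Rightarrow> ('a \<Rightarrow> 'a \<Rightarrow> complex) \<Rightarrow> complex" where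
  "pairing S A B = (\<Sum>x\<in>S. \<Sum>y\<in>S. A x y * B y x)"

lemma pairing_cong:
  assumes "\<And>x y. x \<in> S \<Longrightarrow> y \<in> S \<Longrightarrow> A x y = A' x y"
    and "\<And>x y. x \<in> S \<Longrightarrow> y \<in> S \<Longrightarrow> B x y = B' x y"
  shows "pairing S A B = pairing S A' B'"
  using assms by (simp add: pairing_def)

text \<open>The trace is the sum of all entries of the Schur product of \<open>A\<close> with the
  transpose of \<open>B\<close>, hence the form of that product at the all-ones vector.\<close>

lemma pairing_nonneg:
  assumes "finite S" "psd_kernel S A" "psd_kernel S B"
  shows "0 \<le> pairing S A B"
proof -
  have "psd_kernel S (\<lambda>x y. A x y * B y x)"
    using psd_kernel_schur_product[OF assms(1,2) psd_kernel_transpose[OF assms(3)]] .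
  then have "0 \<le> quad_form S (\<lambda>x y. A x y * B y x) (\<lambda>_. 1)" unfolding psd_kernel_def by blast
  then show ?thesis by (simp add: quad_form_def pairing_def)
qed

lemma pairing_add_left: "pairing S (\<lambda>x y. A x y + A' x y) B = pairing S A B + pairing S A' B"
  by (simp add: pairing_def distrib_right sum.distrib)

lemma pairing_add_right: "pairing S A (\<lambda>x y. B x y + B' x y) = pairing S A B + pairing S A B'"
  by (simp add: pairing_def distrib_left sum.distrib)

lemma pairing_diff_right: "pairing S A (\<lambda>x y. B x y - B' x y) = pairing S A B - pairing S A B'"
  by (simp add: pairing_def right_diff_distrib sum_subtractf)

lemma pairing_rank_one: "pairing S A (\<lambda>x y. f x * cnj (f y)) = quad_form S A f"
  by (simp add: pairing_def quad_form_def mult_ac)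

abbreviation id_kernel :: "'a \<Rightarrow> 'a \<Rightarrow> complex" where
  "id_kernel x y \<equiv> of_bool (x = y)"

lemma quad_form_id:
  assumes "finite S"
  shows "quad_form S id_kernel v = complex_of_real (\<Sum>x\<in>S. (cmod (v x))\<^sup>2)"
proof -
  have "quad_form S id_kernel v = (\<Sum>x\<in>S. \<Sum>y\<in>S. if x = y then cnj (v x) * v y else 0)"
    unfolding quad_form_def by (intro sum.cong refl) simp
  also have "\<dots> = (\<Sum>x\<in>S. v x * cnj (v x))"
    using assms by (simp add: mult.commute)
  finally show ?thesis unfolding of_real_sum complex_norm_square .
qed

lemma psd_kernel_id: "finite S \<Longrightarrow> psd_kernel S id_kernel"
  by (simp add: psd_kernel_def quad_form_id less_eq_complex_def sum_nonneg)

lemma cmod_sum_mult_le: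
  "(cmod (\<Sum>x\<in>S. f x * g x))\<^sup>2 \<le> (\<Sum>x\<in>S. (cmod (f x))\<^sup>2) * (\<Sum>x\<in>S. (cmod (g x))\<^sup>2)"
proof -
  have "cmod (\<Sum>x\<in>S. f x * g x) \<le> (\<Sum>x\<in>S. cmod (f x) * cmod (g x))"
    by (rule order_trans[OF norm_sum]) (simp add: norm_mult)
  then have "(cmod (\<Sum>x\<in>S. f x * g x))\<^sup>2 \<le> (\<Sum>x\<in>S. cmod (f x) * cmod (g x))\<^sup>2"
    by (intro power_mono) auto
  also have "\<dots> \<le> (\<Sum>x\<in>S. (cmod (f x))\<^sup>2) * (\<Sum>x\<in>S. (cmod (g x))\<^sup>2)"
    by (rule Cauchy_Schwarz_ineq_sum)
  finally show ?thesis .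
qed

lemma psd_kernel_id_minus_rank_one:
  assumes "finite S" "(\<Sum>x\<in>S. (cmod (f x))\<^sup>2) \<le> 1"
  shows "psd_kernel S (\<lambda>x y. id_kernel x y - f x * cnj (f y))"
  unfolding psd_kernel_def
proof
  fix v :: "'a \<Rightarrow> complex"
  let ?N = "\<Sum>x\<in>S. (cmod (v x))\<^sup>2"
  let ?p = "\<Sum>x\<in>S. cnj (v x) * f x"
  have "quad_form S (\<lambda>x y. id_kernel x y - f x * cnj (f y)) v
      = quad_form S id_kernel v - quad_form S (\<lambda>x y. f x * cnj (f y)) v"
    by (simp add: quad_form_def left_diff_distrib right_diff_distrib sum_subtractf)
  also have "\<dots> = complex_of_real (?N - (cmod ?p)\<^sup>2)"
    unfolding quad_form_id[OF assms(1)] quad_form_rank_one complex_norm_square[symmetric] by simp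
  finally have eq: "quad_form S (\<lambda>x y. id_kernel x y - f x * cnj (f y)) v
    = complex_of_real (?N - (cmod ?p)\<^sup>2)" .
  have "(cmod ?p)\<^sup>2 \<le> ?N * (\<Sum>x\<in>S. (cmod (f x))\<^sup>2)"
    using cmod_sum_mult_le[of "\<lambda>x. cnj (v x)" f S] by simp
  also have "\<dots> \<le> ?N * 1" using assms(2) by (intro mult_left_mono sum_nonneg) auto
  finally show "0 \<le> quad_form S (\<lambda>x y. id_kernel x y - f x * cnj (f y)) v"
    unfolding eq by (simp add: less_eq_complex_def)
qed

section \<open>Partial transposition and rank-one kernels\<close>

text \<open>The first index is transposed, which for Choi kernels is the input index; this amounts
  to composing the map with the transposition on its input side.\<close>

definition partial_transpose ::
  "('i \<times> 'r \<Rightarrow> 'i \<times> 'r \<Rightarrow> complex) \<Rightarrow> 'i \<times> 'r \<Rightarrow> 'i \<times> 'r \<Rightarrow> complex" where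
  "partial_transpose K x y = K (fst y, snd x) (fst x, snd y)"

lemma partial_transpose_twice [simp]: "partial_transpose (partial_transpose K) = K"
  by (simp add: partial_transpose_def fun_eq_iff)

lemma partial_transpose_id [simp]: "partial_transpose id_kernel = id_kernel"
  by (auto simp: partial_transpose_def fun_eq_iff)

text \<open>Reading \<open>v\<close> and \<open>f\<close> as matrices with rows indexed by
  \<open>I\<close>, the inner sums are the entries of a matrix \<open>M\<close>, and the form
  becomes \<open>tr (M (cnj M))\<close> with entrywise conjugation.\<close>

lemma quad_form_partial_transpose_rank_one:
  "quad_form (I \<times> J) (partial_transpose (\<lambda>x y. f x * cnj (f y))) v =
    (\<Sum>i\<in>I. \<Sum>j\<in>I. (\<Sum>r\<in>J. cnj (v (i, r)) * f (j, r)) * cnj (\<Sum>r\<in>J. cnj (v (j, r)) * f (i, r)))"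
proof -
  have "quad_form (I \<times> J) (partial_transpose (\<lambda>x y. f x * cnj (f y))) v =
    (\<Sum>i\<in>I. \<Sum>r\<in>J. \<Sum>j\<in>I. \<Sum>s\<in>J. (cnj (v (i, r)) * f (j, r)) * cnj (cnj (v (j, s)) * f (i, s)))"
    by (simp add: quad_form_def partial_transpose_def sum.cartesian_product' mult_ac)
  also have "\<dots> = (\<Sum>i\<in>I. \<Sum>j\<in>I. \<Sum>r\<in>J. \<Sum>s\<in>J. (cnj (v (i, r)) * f (j, r)) * cnj (cnj (v (j, s)) * f (i, s)))"
    by (intro sum.cong refl sum.swap)
  also have "\<dots> = (\<Sum>i\<in>I. \<Sum>j\<in>I. (\<Sum>r\<in>J. cnj (v (i, r)) * f (j, r)) * cnj (\<Sum>r\<in>J. cnj (v (j, r)) * f (i, r)))"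
    unfolding cnj_sum sum_product ..
  finally show ?thesis .
qed

lemma abs_Re_mult_cnj_le: "\<bar>Re (z * cnj w)\<bar> \<le> ((cmod z)\<^sup>2 + (cmod w)\<^sup>2) / 2"
proof -
  have "\<bar>Re (z * cnj w)\<bar> \<le> cmod z * cmod w"
    by (rule order_trans[OF abs_Re_le_cmod]) (simp add: norm_mult)
  also have "\<dots> \<le> ((cmod z)\<^sup>2 + (cmod w)\<^sup>2) / 2"
    using sum_squares_bound[of "cmod z" "cmod w"] by simp
  finally show ?thesis .
qed

text \<open>Partial transposition of a rank-one kernel of norm at most 1 leaves the operator norm at
  most 1. The arithmetic-geometric mean inequality bounds the form by the squared Hilbert-Schmidt
  norm of \<open>?M\<close>, and Cauchy-Schwarz on each entry bounds that by the product of the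
  squared norms of \<open>v\<close> and \<open>f\<close>.\<close>

lemma abs_quad_form_partial_transpose_rank_one_le:
  assumes "finite I" "finite J" "(\<Sum>x\<in>I \<times> J. (cmod (f x))\<^sup>2) \<le> 1"
  shows "\<bar>Re (quad_form (I \<times> J) (partial_transpose (\<lambda>x y. f x * cnj (f y))) v)\<bar>
    \<le> (\<Sum>x\<in>I \<times> J. (cmod (v x))\<^sup>2)"
proof -
  let ?M = "\<lambda>i j. \<Sum>r\<in>J. cnj (v (i, r)) * f (j, r)"
  have "\<bar>Re (quad_form (I \<times> J) (partial_transpose (\<lambda>x y. f x * cnj (f y))) v)\<bar>
      \<le> (\<Sum>i\<in>I. \<Sum>j\<in>I. ((cmod (?M i j))\<^sup>2 + (cmod (?M j i))\<^sup>2) / 2)"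
    unfolding quad_form_partial_transpose_rank_one Re_sum
    by (intro order_trans[OF sum_abs] sum_mono abs_Re_mult_cnj_le)
  also have "\<dots> = (\<Sum>i\<in>I. \<Sum>j\<in>I. (cmod (?M i j))\<^sup>2 / 2) + (\<Sum>i\<in>I. \<Sum>j\<in>I. (cmod (?M j i))\<^sup>2 / 2)"
    by (simp add: add_divide_distrib sum.distrib)
  also have "(\<Sum>i\<in>I. \<Sum>j\<in>I. (cmod (?M j i))\<^sup>2 / 2) = (\<Sum>i\<in>I. \<Sum>j\<in>I. (cmod (?M i j))\<^sup>2 / 2)"
    by (rule sum.swap)
  also have "(\<Sum>i\<in>I. \<Sum>j\<in>I. (cmod (?M i j))\<^sup>2 / 2) + (\<Sum>i\<in>I. \<Sum>j\<in>I. (cmod (?M i j))\<^sup>2 / 2)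
      = (\<Sum>i\<in>I. \<Sum>j\<in>I. (cmod (?M i j))\<^sup>2)"
    by (simp flip: sum.distrib)
  also have "\<dots> \<le> (\<Sum>i\<in>I. \<Sum>j\<in>I. (\<Sum>r\<in>J. (cmod (v (i, r)))\<^sup>2) * (\<Sum>r\<in>J. (cmod (f (j, r)))\<^sup>2))"
    using cmod_sum_mult_le[of "\<lambda>r. cnj (v (_, r))"] by (intro sum_mono) simp
  also have "\<dots> = (\<Sum>x\<in>I \<times> J. (cmod (v x))\<^sup>2) * (\<Sum>x\<in>I \<times> J. (cmod (f x))\<^sup>2)"
    by (simp add: sum.cartesian_product' sum_product[symmetric])
  also have "\<dots> \<le> (\<Sum>x\<in>I \<times> J. (cmod (v x))\<^sup>2) * 1"
    using assms(3) by (intro mult_left_mono sum_nonneg) auto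
  finally show ?thesis by simp
qed

text \<open>The norm bound says that \<open>K\<close> lies between minus the identity and the
  identity. In the witness the plus sign serves \<open>G\<close>, the minus sign the partial
  transpose of \<open>W\<close>.\<close>

lemma psd_kernel_id_partial_transpose_rank_one:
  fixes f :: "'i \<times> 'r \<Rightarrow> complex"
  assumes "finite I" "finite J" "(\<Sum>x\<in>I \<times> J. (cmod (f x))\<^sup>2) \<le> 1"
  defines "K \<equiv> partial_transpose (\<lambda>x y. f x * cnj (f y))"
  shows "psd_kernel (I \<times> J) (\<lambda>x y. id_kernel x y + K x y)"
    and "psd_kernel (I \<times> J) (\<lambda>x y. id_kernel x y - K x y)"
proof -
  have herm: "cnj (K x y) = K y x" for x y by (simp add: K_def partial_transpose_def)
  have add: "quad_form (I \<times> J) (\<lambda>x y. id_kernel x y + K x y) v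
      = quad_form (I \<times> J) id_kernel v + quad_form (I \<times> J) K v" for v
    by (simp add: quad_form_def distrib_left distrib_right sum.distrib)
  have diff: "quad_form (I \<times> J) (\<lambda>x y. id_kernel x y - K x y) v
      = quad_form (I \<times> J) id_kernel v - quad_form (I \<times> J) K v" for v
    by (simp add: quad_form_def left_diff_distrib right_diff_distrib sum_subtractf)
  have le: "\<bar>Re (quad_form (I \<times> J) K v)\<bar> \<le> Re (quad_form (I \<times> J) id_kernel v)" for v
    using abs_quad_form_partial_transpose_rank_one_le[OF assms(1-3)] assms(1,2)
    by (simp add: K_def quad_form_id)
  show "psd_kernel (I \<times> J) (\<lambda>x y. id_kernel x y + K x y)"
  proof (rule psd_kernelI)
    show "0 \<le> Re (quad_form (I \<times> J) (\<lambda>x y. id_kernel x y + K x y) v)" for v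
      unfolding add using le[of v] by simp
  qed (auto simp: herm)
  show "psd_kernel (I \<times> J) (\<lambda>x y. id_kernel x y - K x y)"
  proof (rule psd_kernelI)
    show "0 \<le> Re (quad_form (I \<times> J) (\<lambda>x y. id_kernel x y - K x y) v)" for v
      unfolding diff using le[of v] by simp
  qed (auto simp: herm)
qed

section \<open>Choi kernels\<close>

definition choi :: "nat \<Rightarrow> (complex mat \<Rightarrow> complex mat) \<Rightarrow> nat \<times> nat \<Rightarrow> nat \<times> nat \<Rightarrow> complex" where
  "choi a L x y = L (mat_unit a (fst x) (fst y)) $$ (snd x, snd y)"

abbreviation rect :: "nat \<Rightarrow> nat \<Rightarrow> (nat \<times> nat) set" where
  "rect a b \<equiv> {..<a} \<times> {..<b}"

lemma linear_map_mat_choi: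
  assumes "linear_map_mat a b L" "X \<in> carrier_mat a a" "r < b" "s < b"
  shows "L X $$ (r, s) = (\<Sum>i<a. \<Sum>j<a. X $$ (i, j) * choi a L (i, r) (j, s))"
  using linear_map_mat_expand[OF assms] by (simp add: choi_def)

lemma linear_map_mat_carrier:
  "linear_map_mat a b L \<Longrightarrow> X \<in> carrier_mat a a \<Longrightarrow> L X \<in> carrier_mat b b"
  by (simp add: linear_map_mat_def)

lemma linear_map_mat_eqI:
  assumes L: "linear_map_mat a b L" "linear_map_mat a b L'" and X: "X \<in> carrier_mat a a"
    and "\<And>x y. x \<in> rect a b \<Longrightarrow> y \<in> rect a b \<Longrightarrow> choi a L x y = choi a L' x y"
  shows "L X = L' X"
proof (rule eq_matI)
  have c: "L X \<in> carrier_mat b b" "L' X \<in> carrier_mat b b"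
    using L X by (simp_all add: linear_map_mat_carrier)
  then show "dim_row (L X) = dim_row (L' X)" "dim_col (L X) = dim_col (L' X)" by simp_all
  fix r s assume "r < dim_row (L' X)" "s < dim_col (L' X)"
  with c have "r < b" "s < b" by simp_all
  then show "L X $$ (r, s) = L' X $$ (r, s)"
    by (simp add: linear_map_mat_choi[OF L(1) X] linear_map_mat_choi[OF L(2) X] assms(4))
qed

section \<open>Complete positivity and complete copositivity through Choi kernels\<close>

lemma psd_iff_psd_kernel:
  "psd d A \<longleftrightarrow> A \<in> carrier_mat d d \<and> psd_kernel {..<d} (\<lambda>i j. A $$ (i, j))"
proof (cases "A \<in> carrier_mat d d")
  case True
  have q: "(A *\<^sub>v v) \<bullet>c v = quad_form {..<d} (\<lambda>i j. A $$ (i, j)) (\<lambda>i. v $ i)"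
    if "v \<in> carrier_vec d" for v
    using True that
    by (simp add: quad_form_def scalar_prod_def lessThan_atLeast0 sum_distrib_left sum_distrib_right mult_ac)
  have "psd_kernel {..<d} (\<lambda>i j. A $$ (i, j))" if p: "\<forall>v\<in>carrier_vec d. 0 \<le> (A *\<^sub>v v) \<bullet>c v"
    unfolding psd_kernel_def
  proof
    fix v :: "nat \<Rightarrow> complex"
    have "quad_form {..<d} (\<lambda>i j. A $$ (i, j)) v = quad_form {..<d} (\<lambda>i j. A $$ (i, j)) (\<lambda>i. vec d v $ i)"
      by (rule quad_form_cong) simp
    also have "\<dots> = (A *\<^sub>v vec d v) \<bullet>c vec d v" by (rule q[symmetric]) simp
    finally show "0 \<le> quad_form {..<d} (\<lambda>i j. A $$ (i, j)) v" using p by simp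
  qed
  moreover have "\<forall>v\<in>carrier_vec d. 0 \<le> (A *\<^sub>v v) \<bullet>c v" if "psd_kernel {..<d} (\<lambda>i j. A $$ (i, j))"
    using that by (simp add: q psd_kernel_def)
  ultimately show ?thesis using True unfolding psd_def by blast
qed (simp add: psd_def)

lemma mat_unit_index:
  "p < d \<Longrightarrow> q < d \<Longrightarrow> mat_unit d i j $$ (p, q) = of_bool (i = p \<and> j = q)"
  by (auto simp: mat_unit_def)

lemma sum_of_bool_two:
  fixes f :: "nat \<Rightarrow> nat \<Rightarrow> complex"
  assumes "P < k" "Q < k"
  shows "(\<Sum>p<k. \<Sum>q<k. of_bool (p = P \<and> q = Q) * f p q) = f P Q"
proof -
  have "(\<Sum>p<k. \<Sum>q<k. of_bool (p = P \<and> q = Q) * f p q) = (\<Sum>p<k. if p = P then f p Q else 0)"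
  proof (intro sum.cong refl)
    fix p
    have "(\<Sum>q<k. of_bool (p = P \<and> q = Q) * f p q) = (\<Sum>q<k. if q = Q then of_bool (p = P) * f p q else 0)"
      by (intro sum.cong) auto
    then show "(\<Sum>q<k. of_bool (p = P \<and> q = Q) * f p q) = (if p = P then f p Q else 0)"
      using assms by simp
  qed
  then show ?thesis using assms by simp
qed

text \<open>The amplified map acts on each \<open>a\<close> by \<open>a\<close> block of
  \<open>X\<close> separately, so only one block contributes to a given entry; with
  \<open>transpose_mat\<close> it is the block in the transposed position.\<close>

lemma tensor_map_amplify_index:
  assumes L: "linear_map_mat a b L" and rs: "r < k * b" "s < k * b"
  shows "tensor_map k k a b id L X $$ (r, s) = (\<Sum>i<a. \<Sum>j<a.
      X $$ (r div b * a + i, s div b * a + j) * choi a L (i, r mod b) (j, s mod b))"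
    and "tensor_map k k a b transpose_mat L X $$ (r, s) = (\<Sum>i<a. \<Sum>j<a.
      X $$ (s div b * a + i, r div b * a + j) * choi a L (i, r mod b) (j, s mod b))"
proof -
  have b: "b > 0" using rs by (cases b) auto
  have d: "r div b < k" "s div b < k" using rs by (simp_all add: less_mult_imp_div_less)
  have dL: "dim_row (L (mat_unit a i j)) = b" "dim_col (L (mat_unit a i j)) = b" for i j
    using linear_map_mat_carrier[OF L mat_unit_carrier] by auto
  have du: "dim_row (mat_unit k p q) = k" "dim_col (mat_unit k p q) = k" for p q
    by (simp_all add: mat_unit_def)
  have k1: "kron (id (mat_unit k p q)) (L (mat_unit a i j)) $$ (r, s)
      = of_bool (p = r div b \<and> q = s div b) * choi a L (i, r mod b) (j, s mod b)" for p q i j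
    using rs d by (simp add: kron_def dL du mat_unit_index choi_def)
  have k2: "kron (transpose_mat (mat_unit k p q)) (L (mat_unit a i j)) $$ (r, s)
      = of_bool (p = s div b \<and> q = r div b) * choi a L (i, r mod b) (j, s mod b)" for p q i j
    using rs d by (simp add: kron_def dL du mat_unit_index choi_def)
  show "tensor_map k k a b id L X $$ (r, s) = (\<Sum>i<a. \<Sum>j<a.
      X $$ (r div b * a + i, s div b * a + j) * choi a L (i, r mod b) (j, s mod b))"
  proof -
    have "tensor_map k k a b id L X $$ (r, s) = (\<Sum>p<k. \<Sum>q<k. of_bool (p = r div b \<and> q = s div b) *
      (\<Sum>i<a. \<Sum>j<a. X $$ (p * a + i, q * a + j) * choi a L (i, r mod b) (j, s mod b)))"
      using rs by (simp only: tensor_map_def index_mat split k1 sum_distrib_left mult_ac)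
    then show ?thesis using d by (simp only: sum_of_bool_two)
  qed
  show "tensor_map k k a b transpose_mat L X $$ (r, s) = (\<Sum>i<a. \<Sum>j<a.
      X $$ (s div b * a + i, r div b * a + j) * choi a L (i, r mod b) (j, s mod b))"
  proof -
    have "tensor_map k k a b transpose_mat L X $$ (r, s) = (\<Sum>p<k. \<Sum>q<k. of_bool (p = s div b \<and> q = r div b) *
      (\<Sum>i<a. \<Sum>j<a. X $$ (p * a + i, q * a + j) * choi a L (i, r mod b) (j, s mod b)))"
      using rs by (simp only: tensor_map_def index_mat split k2 sum_distrib_left mult_ac)
    then show ?thesis using d by (simp only: sum_of_bool_two)
  qed
qed

text \<open>Before the summation over \<open>i\<close> and \<open>j\<close> this is a Schur product
  of pullbacks of \<open>X\<close> and \<open>C\<close> to pairs of an output position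
  \<open>r\<close> and an input index \<open>i\<close>. The double sum is then a
  contraction.\<close>

lemma psd_kernel_amplify:
  assumes X: "psd_kernel {..<k * a} X" and C: "psd_kernel (rect a b) C"
  shows "psd_kernel {..<k * b} (\<lambda>r s. \<Sum>i<a. \<Sum>j<a.
      X (r div b * a + i) (s div b * a + j) * C (i, r mod b) (j, s mod b))"
proof (rule psd_kernel_contract, rule psd_kernel_pullback_product[OF _ _ _ X C])
  fix x assume x: "x \<in> {..<k * b} \<times> {..<a}"
  then have "b > 0" by (cases b) auto
  with x show "fst x div b * a + snd x \<in> {..<k * a}" "(snd x, fst x mod b) \<in> rect a b"
    by (auto simp: less_mult_imp_div_less index_pair_less)
qed auto

lemma completely_positiveI:
  assumes L: "linear_map_mat a b L" and C: "psd_kernel (rect a b) (choi a L)"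
  shows "completely_positive a b L"
  unfolding completely_positive_def positive_map_def
proof (intro conjI allI impI L linear_map_mat_tensor_map)
  fix k X assume "psd (k * a) X"
  then have X: "psd_kernel {..<k * a} (\<lambda>i j. X $$ (i, j))" by (simp add: psd_iff_psd_kernel)
  have "psd_kernel {..<k * b} (\<lambda>r s. tensor_map k k a b id L X $$ (r, s))"
    using psd_kernel_amplify[OF X C]
    by (subst psd_kernel_cong) (auto simp: tensor_map_amplify_index[OF L])
  then show "psd (k * b) (tensor_map k k a b id L X)"
    by (simp add: psd_iff_psd_kernel tensor_map_def)
qed

lemma completely_copositiveI:
  assumes L: "linear_map_mat a b L" and C: "psd_kernel (rect a b) (partial_transpose (choi a L))"
  shows "completely_copositive a b L"
  unfolding completely_copositive_def positive_map_def
proof (intro conjI allI impI L linear_map_mat_tensor_map)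
  fix k X assume "psd (k * a) X"
  then have X: "psd_kernel {..<k * a} (\<lambda>i j. X $$ (j, i))"
    by (simp add: psd_iff_psd_kernel psd_kernel_transpose[of _ "\<lambda>i j. X $$ (i, j)"])
  \<comment> \<open>Transposing the ancilla equals transposing all of \<open>X\<close> and then the
    input index once more; exchanging \<open>i\<close> and \<open>j\<close> moves the latter to the
    Choi kernel.\<close>
  have "tensor_map k k a b transpose_mat L X $$ (r, s) = (\<Sum>i<a. \<Sum>j<a.
      X $$ (s div b * a + j, r div b * a + i) * partial_transpose (choi a L) (i, r mod b) (j, s mod b))"
    if "r < k * b" "s < k * b" for r s
    unfolding tensor_map_amplify_index[OF L that]
    by (subst sum.swap) (simp add: partial_transpose_def)
  then have "psd_kernel {..<k * b} (\<lambda>r s. tensor_map k k a b transpose_mat L X $$ (r, s))"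
    using psd_kernel_amplify[OF X C] by (subst psd_kernel_cong) auto
  then show "psd (k * b) (tensor_map k k a b transpose_mat L X)"
    by (simp add: psd_iff_psd_kernel tensor_map_def)
qed

lemma positive_mapI:
  assumes L: "linear_map_mat a b L" and C: "psd_kernel (rect a b) (choi a L)"
  shows "positive_map a b L"
  unfolding positive_map_def
proof (intro conjI allI impI L)
  fix X assume "psd a X"
  then have Xc: "X \<in> carrier_mat a a" and X: "psd_kernel {..<a} (\<lambda>i j. X $$ (i, j))"
    by (simp_all add: psd_iff_psd_kernel)
  have "psd_kernel {..<b} (\<lambda>r s. \<Sum>i<a. \<Sum>j<a. X $$ (i, j) * choi a L (i, r) (j, s))"
    by (rule psd_kernel_contract, rule psd_kernel_pullback_product[OF _ _ _ X C]) auto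
  then have "psd_kernel {..<b} (\<lambda>r s. L X $$ (r, s))"
    by (subst psd_kernel_cong) (auto simp: linear_map_mat_choi[OF L Xc])
  then show "psd b (L X)" by (simp add: psd_iff_psd_kernel linear_map_mat_carrier[OF L Xc])
qed

text \<open>The Choi matrix is the image of the unnormalized maximally entangled state.\<close>
lemma completely_positive_imp_psd_choi:
  assumes "completely_positive a b L"
  shows "psd_kernel (rect a b) (choi a L)"
\<comment> \<open>The ancilla is chosen of size \<open>a\<close>, which the definition allows only
  for \<open>a \<ge> 1\<close>; for \<open>a = 0\<close> the index set is empty.\<close>
proof (cases "a = 0")
  case False
  let ?f = "\<lambda>m :: nat. of_bool (m div a = m mod a) :: complex"
  define X where "X = mat (a * a) (a * a) (\<lambda>(m, n). ?f m * cnj (?f n))"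
  have "psd_kernel {..<a * a} (\<lambda>m n. ?f m * cnj (?f n))" by (rule psd_kernel_rank_one)
  then have "psd_kernel {..<a * a} (\<lambda>m n. X $$ (m, n))"
    by (subst psd_kernel_cong) (auto simp: X_def)
  then have "psd (a * a) X" by (simp add: psd_iff_psd_kernel X_def)
  with assms False have "psd (a * b) (tensor_map a a a b id L X)"
    by (simp add: completely_positive_def positive_map_def)
  then have "psd_kernel {..<a * b} (\<lambda>r s. tensor_map a a a b id L X $$ (r, s))"
    by (simp add: psd_iff_psd_kernel)
  then have *: "psd_kernel (rect a b)
      (\<lambda>x y. tensor_map a a a b id L X $$ (fst x * b + snd x, fst y * b + snd y))"
    by (rule psd_kernel_pullback[rotated]) (auto simp: index_pair_less)
  have L: "linear_map_mat a b L" using assms by (simp add: completely_positive_def)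
  have "tensor_map a a a b id L X $$ (p * b + r, q * b + s) = choi a L (p, r) (q, s)"
    if "p < a" "q < a" "r < b" "s < b" for p q r s
  proof -
    have "tensor_map a a a b id L X $$ (p * b + r, q * b + s)
        = (\<Sum>i<a. \<Sum>j<a. of_bool (i = p \<and> j = q) * choi a L (i, r) (j, s))"
      using that unfolding tensor_map_amplify_index(1)[OF L index_pair_less[OF that(1,3)] index_pair_less[OF that(2,4)]]
      by (intro sum.cong refl) (auto simp: X_def index_pair_less)
    also have "\<dots> = choi a L (p, r) (q, s)" using that by (simp only: sum_of_bool_two)
    finally show ?thesis .
  qed
  with * show ?thesis by (subst psd_kernel_cong) (auto simp: choi_def)
qed (simp add: psd_kernel_def quad_form_def)

section \<open>Tensor products of kernels\<close>

lemma pairing_partial_transpose: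
  "pairing (I \<times> J) (partial_transpose A) (partial_transpose B) = pairing (I \<times> J) A B"
proof -
  have "pairing (I \<times> J) (partial_transpose A) (partial_transpose B)
      = (\<Sum>i\<in>I. \<Sum>r\<in>J. \<Sum>j\<in>I. \<Sum>s\<in>J. A (j, r) (i, s) * B (i, s) (j, r))"
    by (simp add: pairing_def partial_transpose_def sum.cartesian_product')
  also have "\<dots> = (\<Sum>i\<in>I. \<Sum>j\<in>I. \<Sum>r\<in>J. \<Sum>s\<in>J. A (j, r) (i, s) * B (i, s) (j, r))"
    by (intro sum.cong refl sum.swap)
  also have "\<dots> = (\<Sum>j\<in>I. \<Sum>i\<in>I. \<Sum>r\<in>J. \<Sum>s\<in>J. A (j, r) (i, s) * B (i, s) (j, r))"
    by (rule sum.swap)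
  also have "\<dots> = (\<Sum>j\<in>I. \<Sum>r\<in>J. \<Sum>i\<in>I. \<Sum>s\<in>J. A (j, r) (i, s) * B (i, s) (j, r))"
    by (intro sum.cong refl sum.swap)
  also have "\<dots> = pairing (I \<times> J) A B"
    by (simp add: pairing_def sum.cartesian_product')
  finally show ?thesis .
qed

text \<open>The Kronecker product, regrouped: \<open>a\<close> and \<open>b\<close> are the sizes of
  the second factor, and input and output indices are split separately. Choi kernels of tensor
  products thus take this form without any further permutation.\<close>

definition tensor_kernel :: "nat \<Rightarrow> nat \<Rightarrow> (nat \<times> nat \<Rightarrow> nat \<times> nat \<Rightarrow> complex) \<Rightarrow>
    (nat \<times> nat \<Rightarrow> nat \<times> nat \<Rightarrow> complex) \<Rightarrow> nat \<times> nat \<Rightarrow> nat \<times> nat \<Rightarrow> complex" where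
  "tensor_kernel a b K1 K2 x y =
     K1 (fst x div a, snd x div b) (fst y div a, snd y div b) *
     K2 (fst x mod a, snd x mod b) (fst y mod a, snd y mod b)"

fun kernel_power :: "nat \<Rightarrow> nat \<Rightarrow> (nat \<times> nat \<Rightarrow> nat \<times> nat \<Rightarrow> complex) \<Rightarrow> nat \<Rightarrow>
    nat \<times> nat \<Rightarrow> nat \<times> nat \<Rightarrow> complex" where
  "kernel_power a b K 0 = (\<lambda>x y. 1)"
| "kernel_power a b K (Suc n) = tensor_kernel (a ^ n) (b ^ n) K (kernel_power a b K n)"

lemma partial_transpose_tensor_kernel:
  "partial_transpose (tensor_kernel a b K1 K2) =
     tensor_kernel a b (partial_transpose K1) (partial_transpose K2)"
  by (simp add: fun_eq_iff partial_transpose_def tensor_kernel_def)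

lemma partial_transpose_kernel_power:
  "partial_transpose (kernel_power a b K n) = kernel_power a b (partial_transpose K) n"
  by (induction n) (simp_all add: partial_transpose_tensor_kernel, simp add: fun_eq_iff partial_transpose_def)

lemma tensor_kernel_id [simp]: "tensor_kernel a b id_kernel id_kernel = id_kernel"
proof (intro ext)
  fix x y :: "nat \<times> nat"
  have "x = y" if "fst x div a = fst y div a" "fst x mod a = fst y mod a"
    "snd x div b = snd y div b" "snd x mod b = snd y mod b"
    using that by (metis div_mult_mod_eq prod_eqI)
  then show "tensor_kernel a b id_kernel id_kernel x y = id_kernel x y"
    by (auto simp: tensor_kernel_def)
qed

lemma rect_div_mod:
  assumes "x \<in> rect (a1 * a2) (b1 * b2)"
  shows "(fst x div a2, snd x div b2) \<in> rect a1 b1" "(fst x mod a2, snd x mod b2) \<in> rect a2 b2"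
proof -
  have "a2 > 0" "b2 > 0" using assms by (cases a2; cases b2; auto)+
  then show "(fst x div a2, snd x div b2) \<in> rect a1 b1" "(fst x mod a2, snd x mod b2) \<in> rect a2 b2"
    using assms by (auto simp: less_mult_imp_div_less)
qed

lemma tensor_kernel_cong:
  assumes "\<And>x y. x \<in> rect a1 b1 \<Longrightarrow> y \<in> rect a1 b1 \<Longrightarrow> K1 x y = K1' x y"
    and "\<And>x y. x \<in> rect a2 b2 \<Longrightarrow> y \<in> rect a2 b2 \<Longrightarrow> K2 x y = K2' x y"
    and "x \<in> rect (a1 * a2) (b1 * b2)" "y \<in> rect (a1 * a2) (b1 * b2)"
  shows "tensor_kernel a2 b2 K1 K2 x y = tensor_kernel a2 b2 K1' K2' x y"
  unfolding tensor_kernel_def using assms(3,4)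
  by (intro arg_cong2[where f = times] assms(1,2) rect_div_mod)

lemma psd_tensor_kernel:
  assumes "psd_kernel (rect a1 b1) K1" "psd_kernel (rect a2 b2) K2"
  shows "psd_kernel (rect (a1 * a2) (b1 * b2)) (tensor_kernel a2 b2 K1 K2)"
  unfolding tensor_kernel_def
  by (rule psd_kernel_pullback_product[OF _ _ _ assms rect_div_mod]) auto

lemma psd_kernel_power:
  assumes "psd_kernel (rect a b) K"
  shows "psd_kernel (rect (a ^ n) (b ^ n)) (kernel_power a b K n)"
proof (induction n)
  case 0
  show ?case using psd_kernel_rank_one[of _ "\<lambda>_. 1"] by simp
next
  case (Suc n)
  then show ?case using psd_tensor_kernel[OF assms Suc] by simp
qed

lemma sum_rect_div_mod:
  "(\<Sum>x\<in>rect (a1 * a2) (b1 * b2). f (fst x div a2, snd x div b2) (fst x mod a2, snd x mod b2))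
     = (\<Sum>u\<in>rect a1 b1. \<Sum>w\<in>rect a2 b2. f u w)"
proof -
  have "(\<Sum>x\<in>rect (a1 * a2) (b1 * b2). f (fst x div a2, snd x div b2) (fst x mod a2, snd x mod b2))
      = (\<Sum>(u, w)\<in>rect a1 b1 \<times> rect a2 b2. f u w)"
    by (rule sum.reindex_bij_witness[of _
          "\<lambda>(u, w). (fst u * a2 + fst w, snd u * b2 + snd w)"
          "\<lambda>x. ((fst x div a2, snd x div b2), (fst x mod a2, snd x mod b2))"])
      (use rect_div_mod in \<open>auto simp: index_pair_less\<close>)
  then show ?thesis by (simp add: sum.cartesian_product)
qed

lemma pairing_tensor_kernel:
  "pairing (rect (a1 * a2) (b1 * b2)) (tensor_kernel a2 b2 A1 A2) (tensor_kernel a2 b2 B1 B2)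
     = pairing (rect a1 b1) A1 B1 * pairing (rect a2 b2) A2 B2"
proof -
  have inner: "(\<Sum>y\<in>rect (a1 * a2) (b1 * b2).
        A1 u (fst y div a2, snd y div b2) * A2 w (fst y mod a2, snd y mod b2) *
        (B1 (fst y div a2, snd y div b2) u * B2 (fst y mod a2, snd y mod b2) w))
      = (\<Sum>u'\<in>rect a1 b1. \<Sum>w'\<in>rect a2 b2. A1 u u' * A2 w w' * (B1 u' u * B2 w' w))" for u w
    by (rule sum_rect_div_mod)
  have "pairing (rect (a1 * a2) (b1 * b2)) (tensor_kernel a2 b2 A1 A2) (tensor_kernel a2 b2 B1 B2)
     = (\<Sum>u\<in>rect a1 b1. \<Sum>w\<in>rect a2 b2. \<Sum>u'\<in>rect a1 b1. \<Sum>w'\<in>rect a2 b2.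
          A1 u u' * A2 w w' * (B1 u' u * B2 w' w))"
    unfolding pairing_def tensor_kernel_def inner by (rule sum_rect_div_mod)
  also have "\<dots> = (\<Sum>u\<in>rect a1 b1. \<Sum>u'\<in>rect a1 b1. \<Sum>w\<in>rect a2 b2. \<Sum>w'\<in>rect a2 b2.
          A1 u u' * A2 w w' * (B1 u' u * B2 w' w))"
    by (intro sum.cong refl sum.swap)
  also have "\<dots> = (\<Sum>u\<in>rect a1 b1. \<Sum>u'\<in>rect a1 b1. (A1 u u' * B1 u' u) * pairing (rect a2 b2) A2 B2)"
    unfolding pairing_def sum_distrib_left by (simp only: mult_ac)
  also have "\<dots> = pairing (rect a1 b1) A1 B1 * pairing (rect a2 b2) A2 B2"
    unfolding pairing_def[of "rect a1 b1"] sum_distrib_right ..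
  finally show ?thesis .
qed

lemma pairing_kernel_power:
  "pairing (rect (a ^ n) (b ^ n)) (kernel_power a b A n) (kernel_power a b B n) = pairing (rect a b) A B ^ n"
proof (induction n)
  case 0
  then show ?case by (simp add: pairing_def lessThan_Suc)
qed (simp add: pairing_tensor_kernel)

text \<open>The restriction to the index set matters from the empty power on: the constant 1 agrees
  with the identity kernel on \<open>rect 1 1\<close> only.\<close>

lemma kernel_power_id:
  "x \<in> rect (a ^ n) (b ^ n) \<Longrightarrow> y \<in> rect (a ^ n) (b ^ n) \<Longrightarrow>
    kernel_power a b id_kernel n x y = id_kernel x y"
proof (induction n arbitrary: x y)
  case (Suc n)
  have "kernel_power a b id_kernel (Suc n) x y = tensor_kernel (a ^ n) (b ^ n) id_kernel id_kernel x y"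
    using Suc.prems unfolding kernel_power.simps
    by (intro tensor_kernel_cong[of a b _ _ "a ^ n" "b ^ n"] Suc.IH) auto
  then show ?case by simp
qed auto

text \<open>Telescoping: with \<open>V\<close> the \<open>n\<close>-th power of \<open>K\<close>,
  one has I \<otimes> I - K \<otimes> V = (I - K) \<otimes> I + K \<otimes> (I - V).\<close>

lemma psd_id_minus_kernel_power:
  assumes "psd_kernel (rect a b) K" "psd_kernel (rect a b) (\<lambda>x y. id_kernel x y - K x y)"
  shows "psd_kernel (rect (a ^ n) (b ^ n)) (\<lambda>x y. id_kernel x y - kernel_power a b K n x y)"
proof (induction n)
  case 0
  have "psd_kernel (rect 1 1) (\<lambda>x y. (0 :: complex))" by (simp add: psd_kernel_def quad_form_def)
  then show ?case by (subst psd_kernel_cong[where K' = "\<lambda>x y. 0"]) auto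
next
  case (Suc n)
  let ?D = "\<lambda>x y. id_kernel x y - K x y"
  let ?D' = "\<lambda>x y. id_kernel x y - kernel_power a b K n x y"
  have "psd_kernel (rect (a * a ^ n) (b * b ^ n)) (\<lambda>x y.
      tensor_kernel (a ^ n) (b ^ n) ?D id_kernel x y + tensor_kernel (a ^ n) (b ^ n) K ?D' x y)"
    by (intro psd_kernel_add psd_tensor_kernel assms Suc psd_kernel_id) auto
  also have "(\<lambda>x y. tensor_kernel (a ^ n) (b ^ n) ?D id_kernel x y + tensor_kernel (a ^ n) (b ^ n) K ?D' x y)
    = (\<lambda>x y. tensor_kernel (a ^ n) (b ^ n) id_kernel id_kernel x y - kernel_power a b K (Suc n) x y)"
    by (simp add: fun_eq_iff tensor_kernel_def algebra_simps del: tensor_kernel_id)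
  finally show ?case by simp
qed

section \<open>Construction of the witness\<close>

lemma not_psd_kernelE:
  assumes "finite S" "\<And>x y. x \<in> S \<Longrightarrow> y \<in> S \<Longrightarrow> K y x = cnj (K x y)" "\<not> psd_kernel S K"
  obtains f c where "(\<Sum>x\<in>S. (cmod (f x))\<^sup>2) \<le> 1" "c < 0" "quad_form S K f = complex_of_real c"
proof -
  obtain v where v: "Re (quad_form S K v) < 0"
    using psd_kernelI[of S K, OF assms(2)] assms(3) by (meson not_le)
  define N where "N = (\<Sum>x\<in>S. (cmod (v x))\<^sup>2)"
  \<comment> \<open>Scaling by \<open>N + 1\<close> instead of \<open>N\<close> avoids a division by
    zero and still gives norm at most 1.\<close>
  define t where "t = 1 / sqrt (N + 1)"
  have N: "N \<ge> 0" by (simp add: N_def sum_nonneg)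
  have t: "t * t = 1 / (N + 1)" "t > 0" using N by (auto simp: t_def)
  let ?f = "\<lambda>x. complex_of_real t * v x"
  have "(\<Sum>x\<in>S. (cmod (?f x))\<^sup>2) = t * t * N"
    using t(2) by (simp add: N_def norm_mult power_mult_distrib sum_distrib_left power2_eq_square mult_ac)
  also have "\<dots> \<le> 1" using N by (simp add: t)
  finally have le: "(\<Sum>x\<in>S. (cmod (?f x))\<^sup>2) \<le> 1" .
  have "quad_form S K ?f = complex_of_real (t * t) * quad_form S K v"
    by (simp add: quad_form_def sum_distrib_left mult_ac)
  also have "quad_form S K v = complex_of_real (Re (quad_form S K v))"
    using quad_form_hermitian_real[of S K v, OF assms(2)] by (simp add: complex_eq_iff)
  finally have "quad_form S K ?f = complex_of_real (t * t * Re (quad_form S K v))" by simp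
  moreover have "t * t * Re (quad_form S K v) < 0" using t(2) v by (simp add: mult_pos_neg)
  ultimately show thesis by (intro that[OF le])
qed

text \<open>After division by \<open>w ^ k\<close> the first term tends to 0 and the second is the
  negative constant \<open>e\<close>.\<close>

lemma exists_power_dominating:
  fixes c1 c2 w e :: real
  assumes "0 \<le> c1" "c1 < w" "e < 0"
  shows "\<exists>k. c2 * c1 ^ k + e * w ^ k < 0"
proof -
  have w: "w > 0" using assms by simp
  have "(\<lambda>k. c2 * (c1 / w) ^ k) \<longlonglongrightarrow> c2 * 0"
    using assms w by (intro tendsto_mult tendsto_const LIMSEQ_power_zero) auto
  then have "\<forall>\<^sub>F k in sequentially. c2 * (c1 / w) ^ k < - e"
    using assms(3) by (intro order_tendstoD(2)[of _ "c2 * 0"]) auto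
  then obtain k where "c2 * (c1 / w) ^ k < - e" by (auto simp: eventually_sequentially)
  then have "c2 * (c1 / w) ^ k * w ^ k < - e * w ^ k"
    using w by (intro mult_strict_right_mono) auto
  also have "c2 * (c1 / w) ^ k * w ^ k = c2 * c1 ^ k" using w by (simp add: power_divide)
  finally show ?thesis by (intro exI[of _ k]) simp
qed

text \<open>Positivity of the witness: \<open>I + G \<otimes> V = I \<otimes> (I - V) + (I + G) \<otimes> V\<close> with \<open>V = W\<^bsup>\<otimes>k\<^esup>\<close>, \<open>0 \<le> V \<le> I\<close>
  and \<open>- I \<le> G\<close>.\<close>
lemma exists_ppt_witness:
  assumes herm1: "\<And>x y. x \<in> rect a1 b1 \<Longrightarrow> y \<in> rect a1 b1 \<Longrightarrow> A1 y x = cnj (A1 x y)"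
    and herm2: "\<And>x y. x \<in> rect a2 b2 \<Longrightarrow> y \<in> rect a2 b2 \<Longrightarrow> A2 y x = cnj (A2 x y)"
    and tr1: "0 \<le> pairing (rect a1 b1) A1 id_kernel"
    and tr2: "0 \<le> pairing (rect a2 b2) A2 id_kernel"
    and n1: "\<not> psd_kernel (rect a1 b1) A1"
    and n2: "\<not> psd_kernel (rect a2 b2) (partial_transpose A2)"
  obtains k \<rho> where "psd_kernel (rect (a2 * a1 ^ k) (b2 * b1 ^ k)) \<rho>"
    and "psd_kernel (rect (a2 * a1 ^ k) (b2 * b1 ^ k)) (partial_transpose \<rho>)"
    and "Re (pairing (rect (a2 * a1 ^ k) (b2 * b1 ^ k))
      (tensor_kernel (a1 ^ k) (b1 ^ k) A2 (kernel_power a1 b1 A1 k)) \<rho>) < 0"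
proof -
  obtain f c where f: "(\<Sum>x\<in>rect a1 b1. (cmod (f x))\<^sup>2) \<le> 1" "c < 0"
      "quad_form (rect a1 b1) A1 f = complex_of_real c"
    using not_psd_kernelE[OF _ herm1 n1] by blast
  have herm2': "partial_transpose A2 y x = cnj (partial_transpose A2 x y)"
    if "x \<in> rect a2 b2" "y \<in> rect a2 b2" for x y
    unfolding partial_transpose_def using that by (intro herm2) auto
  obtain g e where g: "(\<Sum>x\<in>rect a2 b2. (cmod (g x))\<^sup>2) \<le> 1" "e < 0"
      "quad_form (rect a2 b2) (partial_transpose A2) g = complex_of_real e"
    using not_psd_kernelE[OF _ herm2' n2] by blast
  define c1 c2 where "c1 = Re (pairing (rect a1 b1) A1 id_kernel)"
    and "c2 = Re (pairing (rect a2 b2) A2 id_kernel)"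
  have c1: "pairing (rect a1 b1) A1 id_kernel = complex_of_real c1" "0 \<le> c1"
    and c2: "pairing (rect a2 b2) A2 id_kernel = complex_of_real c2"
    using tr1 tr2 by (auto simp: c1_def c2_def complex_eq_iff less_eq_complex_def)
  define W where "W = (\<lambda>x y. id_kernel x y - f x * cnj (f y))"
  define G where "G = partial_transpose (\<lambda>x y. g x * cnj (g y))"
  have ptW: "partial_transpose W = (\<lambda>x y. id_kernel x y - partial_transpose (\<lambda>x y. f x * cnj (f y)) x y)"
    by (auto simp: W_def partial_transpose_def fun_eq_iff)
  have W: "psd_kernel (rect a1 b1) W" "psd_kernel (rect a1 b1) (\<lambda>x y. id_kernel x y - W x y)"
    unfolding W_def using psd_kernel_id_minus_rank_one[OF _ f(1)] psd_kernel_rank_one[of _ f] by simp_all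
  have W': "psd_kernel (rect a1 b1) (partial_transpose W)"
    unfolding ptW by (rule psd_kernel_id_partial_transpose_rank_one(2)[OF _ _ f(1)]) auto
  have G: "psd_kernel (rect a2 b2) (\<lambda>x y. id_kernel x y + G x y)"
    unfolding G_def by (rule psd_kernel_id_partial_transpose_rank_one(1)[OF _ _ g(1)]) auto
  have G': "psd_kernel (rect a2 b2) (partial_transpose G)"
    unfolding G_def partial_transpose_twice by (rule psd_kernel_rank_one)
  have pW: "pairing (rect a1 b1) A1 W = complex_of_real (c1 - c)"
    unfolding W_def pairing_diff_right pairing_rank_one f(3) c1 by simp
  \<comment> \<open>Under the trace the partial transposition passes from \<open>G\<close> to
    \<open>A2\<close>, which leaves the negative value of its form at \<open>g\<close>.\<close>
  have pG: "pairing (rect a2 b2) A2 G = complex_of_real e"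
    using pairing_partial_transpose[of "{..<a2}" "{..<b2}" "partial_transpose A2" "\<lambda>x y. g x * cnj (g y)"]
    unfolding G_def partial_transpose_twice pairing_rank_one g(3) .
  \<comment> \<open>Since \<open>c < 0\<close>, the base \<open>c1 - c\<close> exceeds
    \<open>c1\<close>, so the term with the negative factor \<open>e\<close> wins for large
    \<open>k\<close>.\<close>
  obtain k where k: "c2 * c1 ^ k + e * (c1 - c) ^ k < 0"
    using exists_power_dominating[of c1 "c1 - c" e c2] c1(2) f(2) g(2) by auto
  let ?S = "rect (a2 * a1 ^ k) (b2 * b1 ^ k)"
  let ?t = "tensor_kernel (a1 ^ k) (b1 ^ k)"
  let ?W = "kernel_power a1 b1 W k"
  define \<rho> where "\<rho> = (\<lambda>x y. id_kernel x y + ?t G ?W x y)"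
  have "psd_kernel ?S (\<lambda>x y. ?t id_kernel (\<lambda>x y. id_kernel x y - ?W x y) x y
      + ?t (\<lambda>x y. id_kernel x y + G x y) ?W x y)"
    by (intro psd_kernel_add psd_tensor_kernel psd_kernel_id psd_id_minus_kernel_power psd_kernel_power W G) auto
  also have "(\<lambda>x y. ?t id_kernel (\<lambda>x y. id_kernel x y - ?W x y) x y + ?t (\<lambda>x y. id_kernel x y + G x y) ?W x y)
      = (\<lambda>x y. ?t id_kernel id_kernel x y + ?t G ?W x y)"
    by (simp add: fun_eq_iff tensor_kernel_def algebra_simps del: tensor_kernel_id)
  finally have 1: "psd_kernel ?S \<rho>" by (simp add: \<rho>_def)
  have "partial_transpose \<rho> = (\<lambda>x y. partial_transpose id_kernel x y + partial_transpose (?t G ?W) x y)"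
    unfolding \<rho>_def by (simp add: partial_transpose_def fun_eq_iff)
  also have "\<dots> = (\<lambda>x y. id_kernel x y + ?t (partial_transpose G) (kernel_power a1 b1 (partial_transpose W) k) x y)"
    by (simp add: partial_transpose_tensor_kernel partial_transpose_kernel_power)
  finally have "partial_transpose \<rho> =
    (\<lambda>x y. id_kernel x y + ?t (partial_transpose G) (kernel_power a1 b1 (partial_transpose W) k) x y)" .
  \<comment> \<open>After partial transposition \<open>G\<close> is a rank-one kernel and
    \<open>W\<close> is still positive, so every summand is a tensor product of positive
    kernels.\<close>
  moreover have "psd_kernel ?S \<dots>"
    by (intro psd_kernel_add psd_tensor_kernel psd_kernel_id psd_kernel_power W' G') auto
  ultimately have 2: "psd_kernel ?S (partial_transpose \<rho>)" by simp
  let ?A = "kernel_power a1 b1 A1 k"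
  \<comment> \<open>The identity kernel is itself a tensor product, so both pairings factor: the
    first into traces of \<open>A2\<close> and \<open>A1\<close>, the second into the values at
    \<open>G\<close> and \<open>W\<close>.\<close>
  have "pairing ?S (?t A2 ?A) \<rho> = pairing ?S (?t A2 ?A) (?t id_kernel id_kernel) + pairing ?S (?t A2 ?A) (?t G ?W)"
    unfolding \<rho>_def pairing_add_right by simp
  also have "pairing ?S (?t A2 ?A) (?t id_kernel id_kernel) = complex_of_real (c2 * c1 ^ k)"
  proof -
    have "pairing (rect (a1 ^ k) (b1 ^ k)) ?A id_kernel
        = pairing (rect (a1 ^ k) (b1 ^ k)) ?A (kernel_power a1 b1 id_kernel k)"
      by (rule pairing_cong) (simp_all only: kernel_power_id)
    then show ?thesis
      unfolding pairing_tensor_kernel by (simp only: pairing_kernel_power c1 c2) simp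
  qed
  also have "pairing ?S (?t A2 ?A) (?t G ?W) = complex_of_real (e * (c1 - c) ^ k)"
    unfolding pairing_tensor_kernel pairing_kernel_power pW pG by simp
  finally have 3: "Re (pairing ?S (?t A2 ?A) \<rho>) < 0" using k by simp
  show thesis by (rule that[OF 1 2 3])
qed

section \<open>Tensor products of maps\<close>

lemma linear_map_mat_comp:
  assumes "linear_map_mat a b L" "linear_map_mat b c M"
  shows "linear_map_mat a c (M \<circ> L)"
  using assms by (simp add: linear_map_mat_def)

lemma positive_map_comp:
  assumes "positive_map a b L" "positive_map b c M"
  shows "positive_map a c (M \<circ> L)"
  using assms by (auto simp: positive_map_def intro: linear_map_mat_comp)

lemma positive_map_cong:
  assumes L: "positive_map a b L" and eq: "\<And>X. X \<in> carrier_mat a a \<Longrightarrow> L X = L' X"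
  shows "positive_map a b L'"
proof -
  have "linear_map_mat a b L'"
    using L unfolding positive_map_def linear_map_mat_def by (simp flip: eq)
  moreover have "psd b (L' X)" if "psd a X" for X
  proof -
    have "X \<in> carrier_mat a a" using that by (simp add: psd_def)
    then show ?thesis using that L by (simp add: positive_map_def flip: eq)
  qed
  ultimately show ?thesis by (simp add: positive_map_def)
qed

section \<open>Choi kernels of tensor products and tensor powers\<close>

lemma mat_unit_kron:
  assumes "x < a1 * a2" "y < a1 * a2"
  shows "mat_unit (a1 * a2) x y = kron (mat_unit a1 (x div a2) (y div a2)) (mat_unit a2 (x mod a2) (y mod a2))"
proof (rule eq_matI)
  fix p q
  assume "p < dim_row (kron (mat_unit a1 (x div a2) (y div a2)) (mat_unit a2 (x mod a2) (y mod a2)))"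
    "q < dim_col (kron (mat_unit a1 (x div a2) (y div a2)) (mat_unit a2 (x mod a2) (y mod a2)))"
  then have pq: "p < a1 * a2" "q < a1 * a2" by (simp_all add: kron_def mat_unit_def)
  then have a2: "a2 > 0" by (cases a2) auto
  have dm: "p div a2 < a1" "q div a2 < a1" "p mod a2 < a2" "q mod a2 < a2"
    using pq a2 by (simp_all add: less_mult_imp_div_less)
  have *: "m = n \<longleftrightarrow> m div a2 = n div a2 \<and> m mod a2 = n mod a2" for m n :: nat
    by (metis div_mult_mod_eq)
  have d: "dim_row (mat_unit n i j) = n" "dim_col (mat_unit n i j) = n" for n i j
    by (simp_all add: mat_unit_def)
  show "mat_unit (a1 * a2) x y $$ (p, q) =
    kron (mat_unit a1 (x div a2) (y div a2)) (mat_unit a2 (x mod a2) (y mod a2)) $$ (p, q)"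
    using pq dm *[of x p] *[of y q] by (simp add: kron_def d mat_unit_index)
qed (simp_all add: kron_def mat_unit_def)

lemma choi_tensor_map:
  assumes L: "linear_map_mat a1 b1 L1" "linear_map_mat a2 b2 L2"
    and xy: "x \<in> rect (a1 * a2) (b1 * b2)" "y \<in> rect (a1 * a2) (b1 * b2)"
  shows "choi (a1 * a2) (tensor_map a1 b1 a2 b2 L1 L2) x y
    = tensor_kernel a2 b2 (choi a1 L1) (choi a2 L2) x y"
proof -
  have c: "L1 (mat_unit a1 i j) \<in> carrier_mat b1 b1" "L2 (mat_unit a2 i j) \<in> carrier_mat b2 b2" for i j
    using L by (simp_all add: linear_map_mat_carrier)
  note d = carrier_matD[OF c(1)] carrier_matD[OF c(2)]
  have m: "mat_unit (a1 * a2) (fst x) (fst y) = kron (mat_unit a1 (fst x div a2) (fst y div a2))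
      (mat_unit a2 (fst x mod a2) (fst y mod a2))"
    using xy by (intro mat_unit_kron) auto
  show ?thesis
    unfolding choi_def m tensor_map_kron[OF L mat_unit_carrier mat_unit_carrier]
    using xy by (auto simp: kron_def d tensor_kernel_def)
qed

lemma psd_choi_tensor_map:
  assumes "linear_map_mat a1 b1 L1" "linear_map_mat a2 b2 L2"
  shows "psd_kernel (rect a1 b1) (choi a1 L1) \<Longrightarrow> psd_kernel (rect a2 b2) (choi a2 L2) \<Longrightarrow>
      psd_kernel (rect (a1 * a2) (b1 * b2)) (choi (a1 * a2) (tensor_map a1 b1 a2 b2 L1 L2))"
    and "psd_kernel (rect a1 b1) (partial_transpose (choi a1 L1)) \<Longrightarrow>
      psd_kernel (rect a2 b2) (partial_transpose (choi a2 L2)) \<Longrightarrow>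
      psd_kernel (rect (a1 * a2) (b1 * b2))
        (partial_transpose (choi (a1 * a2) (tensor_map a1 b1 a2 b2 L1 L2)))"
proof -
  note eq = choi_tensor_map[OF assms]
  assume "psd_kernel (rect a1 b1) (choi a1 L1)" "psd_kernel (rect a2 b2) (choi a2 L2)"
  from psd_tensor_kernel[OF this]
  show "psd_kernel (rect (a1 * a2) (b1 * b2)) (choi (a1 * a2) (tensor_map a1 b1 a2 b2 L1 L2))"
    by (subst psd_kernel_cong[OF eq])
next
  assume "psd_kernel (rect a1 b1) (partial_transpose (choi a1 L1))"
    "psd_kernel (rect a2 b2) (partial_transpose (choi a2 L2))"
  from psd_tensor_kernel[OF this]
  have "psd_kernel (rect (a1 * a2) (b1 * b2)) (partial_transpose (tensor_kernel a2 b2 (choi a1 L1) (choi a2 L2)))"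
    by (simp add: partial_transpose_tensor_kernel)
  then show "psd_kernel (rect (a1 * a2) (b1 * b2))
        (partial_transpose (choi (a1 * a2) (tensor_map a1 b1 a2 b2 L1 L2)))"
    by (subst psd_kernel_cong) (auto simp: partial_transpose_def choi_tensor_map[OF assms])
qed

lemma linear_map_mat_tensor_power:
  "linear_map_mat (a ^ n) (b ^ n) (tensor_power a b L n)"
proof (cases n)
  case 0
  then show ?thesis by (simp add: linear_map_mat_def)
qed (simp add: linear_map_mat_tensor_map)

lemma choi_tensor_power:
  assumes "linear_map_mat a b L"
  shows "x \<in> rect (a ^ n) (b ^ n) \<Longrightarrow> y \<in> rect (a ^ n) (b ^ n) \<Longrightarrow>
    choi (a ^ n) (tensor_power a b L n) x y = kernel_power a b (choi a L) n x y"
proof (induction n arbitrary: x y)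
  case 0
  then show ?case by (auto simp: choi_def mat_unit_def)
next
  case (Suc n)
  have "choi (a ^ Suc n) (tensor_power a b L (Suc n)) x y
      = tensor_kernel (a ^ n) (b ^ n) (choi a L) (choi (a ^ n) (tensor_power a b L n)) x y"
    using Suc.prems choi_tensor_map[OF assms linear_map_mat_tensor_power[of a n b L]] by simp
  also have "\<dots> = kernel_power a b (choi a L) (Suc n) x y"
    unfolding kernel_power.simps using Suc.prems
    by (intro tensor_kernel_cong[of a b _ _ "a ^ n" "b ^ n"] Suc.IH) auto
  finally show ?case .
qed

lemma psd_choi_tensor_power:
  assumes "linear_map_mat a b L"
  shows "psd_kernel (rect a b) (choi a L) \<Longrightarrow>
      psd_kernel (rect (a ^ n) (b ^ n)) (choi (a ^ n) (tensor_power a b L n))"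
    and "psd_kernel (rect a b) (partial_transpose (choi a L)) \<Longrightarrow>
      psd_kernel (rect (a ^ n) (b ^ n)) (partial_transpose (choi (a ^ n) (tensor_power a b L n)))"
proof -
  assume "psd_kernel (rect a b) (choi a L)"
  from psd_kernel_power[OF this, of n]
  show "psd_kernel (rect (a ^ n) (b ^ n)) (choi (a ^ n) (tensor_power a b L n))"
    by (subst psd_kernel_cong[OF choi_tensor_power[OF assms]])
next
  assume "psd_kernel (rect a b) (partial_transpose (choi a L))"
  from psd_kernel_power[OF this, of n]
  show "psd_kernel (rect (a ^ n) (b ^ n)) (partial_transpose (choi (a ^ n) (tensor_power a b L n)))"
    unfolding partial_transpose_kernel_power[symmetric]
    by (subst psd_kernel_cong) (auto simp: partial_transpose_def choi_tensor_power[OF assms])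
qed

section \<open>Composition and associativity of tensor powers\<close>

text \<open>Both sides are linear, so it suffices to compare them on matrix units, which are
  Kronecker products of smaller matrix units.\<close>

lemma tensor_map_comp:
  assumes L: "linear_map_mat a1 b1 L1" "linear_map_mat a2 b2 L2"
    and M: "linear_map_mat b1 c1 M1" "linear_map_mat b2 c2 M2"
    and X: "X \<in> carrier_mat (a1 * a2) (a1 * a2)"
  shows "tensor_map b1 c1 b2 c2 M1 M2 (tensor_map a1 b1 a2 b2 L1 L2 X)
    = tensor_map a1 c1 a2 c2 (M1 \<circ> L1) (M2 \<circ> L2) X"
proof -
  have "(tensor_map b1 c1 b2 c2 M1 M2 \<circ> tensor_map a1 b1 a2 b2 L1 L2) X
    = tensor_map a1 c1 a2 c2 (M1 \<circ> L1) (M2 \<circ> L2) X"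
  proof (rule linear_map_mat_eqI[OF linear_map_mat_comp[OF linear_map_mat_tensor_map linear_map_mat_tensor_map]
        linear_map_mat_tensor_map X])
    fix x y assume xy: "x \<in> rect (a1 * a2) (c1 * c2)" "y \<in> rect (a1 * a2) (c1 * c2)"
    let ?E = "mat_unit a1 (fst x div a2) (fst y div a2)" and ?F = "mat_unit a2 (fst x mod a2) (fst y mod a2)"
    have m: "mat_unit (a1 * a2) (fst x) (fst y) = kron ?E ?F"
      using xy by (intro mat_unit_kron) auto
    have "tensor_map b1 c1 b2 c2 M1 M2 (tensor_map a1 b1 a2 b2 L1 L2 (kron ?E ?F))
        = tensor_map a1 c1 a2 c2 (M1 \<circ> L1) (M2 \<circ> L2) (kron ?E ?F)"
      using tensor_map_kron[OF L mat_unit_carrier mat_unit_carrier]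
        tensor_map_kron[OF M linear_map_mat_carrier[OF L(1) mat_unit_carrier]
          linear_map_mat_carrier[OF L(2) mat_unit_carrier]]
        tensor_map_kron[OF linear_map_mat_comp[OF L(1) M(1)] linear_map_mat_comp[OF L(2) M(2)]
          mat_unit_carrier mat_unit_carrier]
      by simp
    then show "choi (a1 * a2) (tensor_map b1 c1 b2 c2 M1 M2 \<circ> tensor_map a1 b1 a2 b2 L1 L2) x y
        = choi (a1 * a2) (tensor_map a1 c1 a2 c2 (M1 \<circ> L1) (M2 \<circ> L2)) x y"
      by (simp add: choi_def m)
  qed
  then show ?thesis by simp
qed

lemma tensor_map_cong:
  assumes "\<And>X. X \<in> carrier_mat a1 a1 \<Longrightarrow> L1 X = L1' X" "\<And>X. X \<in> carrier_mat a2 a2 \<Longrightarrow> L2 X = L2' X"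
  shows "tensor_map a1 b1 a2 b2 L1 L2 X = tensor_map a1 b1 a2 b2 L1' L2' X"
  unfolding tensor_map_def by (simp add: assms)

lemma tensor_power_comp:
  assumes L: "linear_map_mat a b L" and M: "linear_map_mat b c M"
  shows "X \<in> carrier_mat (a ^ n) (a ^ n) \<Longrightarrow>
    tensor_power b c M n (tensor_power a b L n X) = tensor_power a c (M \<circ> L) n X"
proof (induction n arbitrary: X)
  case (Suc n)
  have "tensor_power b c M (Suc n) (tensor_power a b L (Suc n) X)
    = tensor_map a c (a ^ n) (c ^ n) (M \<circ> L) (tensor_power b c M n \<circ> tensor_power a b L n) X"
    using tensor_map_comp[OF L linear_map_mat_tensor_power M linear_map_mat_tensor_power] Suc.prems
    by simp
  also have "\<dots> = tensor_power a c (M \<circ> L) (Suc n) X"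
    unfolding tensor_power.simps by (intro tensor_map_cong refl, subst comp_apply) (rule Suc.IH)
  finally show ?case .
qed simp

text \<open>Both Choi kernels are products of three factors; the two nestings split an index by
  \<open>div\<close> and \<open>mod\<close> into the same three digits.\<close>

lemma tensor_map_assoc:
  assumes L: "linear_map_mat a1 b1 L1" "linear_map_mat a2 b2 L2" "linear_map_mat a3 b3 L3"
    and X: "X \<in> carrier_mat (a1 * a2 * a3) (a1 * a2 * a3)"
  shows "tensor_map (a1 * a2) (b1 * b2) a3 b3 (tensor_map a1 b1 a2 b2 L1 L2) L3 X
    = tensor_map a1 b1 (a2 * a3) (b2 * b3) L1 (tensor_map a2 b2 a3 b3 L2 L3) X"
proof (rule linear_map_mat_eqI[OF linear_map_mat_tensor_map _ X])
  show "linear_map_mat (a1 * a2 * a3) (b1 * b2 * b3)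
      (tensor_map a1 b1 (a2 * a3) (b2 * b3) L1 (tensor_map a2 b2 a3 b3 L2 L3))"
    using linear_map_mat_tensor_map[of a1 "a2 * a3" b1 "b2 * b3"] by (simp add: mult.assoc)
  fix x y assume xy: "x \<in> rect (a1 * a2 * a3) (b1 * b2 * b3)" "y \<in> rect (a1 * a2 * a3) (b1 * b2 * b3)"
  then have xy': "x \<in> rect (a1 * (a2 * a3)) (b1 * (b2 * b3))" "y \<in> rect (a1 * (a2 * a3)) (b1 * (b2 * b3))"
    by (simp_all add: mult.assoc)
  have mm: "m mod (p * q) mod q = m mod q" for m p q :: nat by (simp add: mod_mod_cancel)
  have md: "m mod (p * q) div q = m div q mod p" for m p q :: nat
    by (cases "q = 0") (simp_all add: mod_mult2_eq[of m q p] mult.commute[of p q])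
  have dd: "m div (p * q) = m div q div p" for m p q :: nat
    by (simp add: div_mult2_eq[of m q p] mult.commute[of p q])
  have "choi (a1 * a2 * a3) (tensor_map (a1 * a2) (b1 * b2) a3 b3 (tensor_map a1 b1 a2 b2 L1 L2) L3) x y
      = tensor_kernel a3 b3 (choi (a1 * a2) (tensor_map a1 b1 a2 b2 L1 L2)) (choi a3 L3) x y"
    by (rule choi_tensor_map[OF linear_map_mat_tensor_map L(3) xy])
  also have "\<dots> = tensor_kernel a3 b3 (tensor_kernel a2 b2 (choi a1 L1) (choi a2 L2)) (choi a3 L3) x y"
    by (rule tensor_kernel_cong[OF choi_tensor_map[OF L(1,2)] refl xy])
  also have "\<dots> = tensor_kernel (a2 * a3) (b2 * b3) (choi a1 L1) (tensor_kernel a3 b3 (choi a2 L2) (choi a3 L3)) x y"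
    by (simp add: tensor_kernel_def mm md dd mult.assoc)
  also have "\<dots> = tensor_kernel (a2 * a3) (b2 * b3) (choi a1 L1) (choi (a2 * a3) (tensor_map a2 b2 a3 b3 L2 L3)) x y"
    by (rule tensor_kernel_cong[OF refl choi_tensor_map[OF L(2,3), symmetric] xy'])
  also have "\<dots> = choi (a1 * (a2 * a3)) (tensor_map a1 b1 (a2 * a3) (b2 * b3) L1 (tensor_map a2 b2 a3 b3 L2 L3)) x y"
    by (rule choi_tensor_map[OF L(1) linear_map_mat_tensor_map xy', symmetric])
  finally show "choi (a1 * a2 * a3) (tensor_map (a1 * a2) (b1 * b2) a3 b3 (tensor_map a1 b1 a2 b2 L1 L2) L3) x y
      = choi (a1 * a2 * a3) (tensor_map a1 b1 (a2 * a3) (b2 * b3) L1 (tensor_map a2 b2 a3 b3 L2 L3)) x y"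
    by (simp add: mult.assoc)
qed

lemma tensor_map_id_left:
  assumes L: "linear_map_mat a b L" and X: "X \<in> carrier_mat a a"
  shows "tensor_map 1 1 a b id L X = L X"
proof -
  have "kron (1\<^sub>m 1) Y = Y" for Y by (intro eq_matI) (auto simp: kron_def)
  moreover have "linear_map_mat 1 1 (id :: complex mat \<Rightarrow> complex mat)" by (simp add: linear_map_mat_def)
  from tensor_map_kron[OF this L one_carrier_mat X]
  have "tensor_map 1 1 a b id L (kron (1\<^sub>m 1) X) = kron (1\<^sub>m 1) (L X)" by simp
  ultimately show ?thesis by (simp only:)
qed

lemma tensor_power_add:
  assumes L: "linear_map_mat a b L"
  shows "X \<in> carrier_mat (a ^ (m + n)) (a ^ (m + n)) \<Longrightarrow>
    tensor_map (a ^ m) (b ^ m) (a ^ n) (b ^ n) (tensor_power a b L m) (tensor_power a b L n) X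
      = tensor_power a b L (m + n) X"
proof (induction m arbitrary: X)
  case 0
  then show ?case
    by (simp only: tensor_power.simps power_0 add_0 tensor_map_id_left[OF linear_map_mat_tensor_power])
next
  case (Suc m)
  have "tensor_map (a ^ Suc m) (b ^ Suc m) (a ^ n) (b ^ n) (tensor_power a b L (Suc m)) (tensor_power a b L n) X
      = tensor_map a b (a ^ m * a ^ n) (b ^ m * b ^ n) L
          (tensor_map (a ^ m) (b ^ m) (a ^ n) (b ^ n) (tensor_power a b L m) (tensor_power a b L n)) X"
    using tensor_map_assoc[OF L linear_map_mat_tensor_power linear_map_mat_tensor_power] Suc.prems
    by (simp add: power_add mult.assoc)
  also have "\<dots> = tensor_map a b (a ^ m * a ^ n) (b ^ m * b ^ n) L (tensor_power a b L (m + n)) X"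
    by (intro tensor_map_cong refl Suc.IH) (simp_all add: power_add)
  finally show ?case by (simp add: power_add)
qed

lemma tensor_power_mult:
  assumes L: "linear_map_mat a b L"
  shows "X \<in> carrier_mat ((a ^ n) ^ m) ((a ^ n) ^ m) \<Longrightarrow>
    tensor_power (a ^ n) (b ^ n) (tensor_power a b L n) m X = tensor_power a b L (m * n) X"
proof (induction m arbitrary: X)
  case (Suc m)
  have p: "(a ^ n) ^ m = a ^ (m * n)" "(b ^ n) ^ m = b ^ (m * n)"
    by (simp_all add: mult.commute flip: power_mult)
  have "tensor_power (a ^ n) (b ^ n) (tensor_power a b L n) (Suc m) X
      = tensor_map (a ^ n) (b ^ n) (a ^ (m * n)) (b ^ (m * n)) (tensor_power a b L n) (tensor_power a b L (m * n)) X"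
    unfolding tensor_power.simps p by (intro tensor_map_cong refl Suc.IH) (simp add: p)
  also have "\<dots> = tensor_power a b L (Suc m * n) X"
    using Suc.prems tensor_power_add[OF L, of X n "m * n"] by (simp add: p power_add)
  finally show ?case .
qed simp

text \<open>Powers of a power are powers of the original map. This permits a second round of the
  argument with a tensor power of \<open>P\<^sub>0\<close> in place of
  \<open>P\<^sub>0\<close>.\<close>

lemma tensor_stable_positive_power:
  assumes P: "tensor_stable_positive a b L" and n: "n \<ge> 1"
  shows "tensor_stable_positive (a ^ n) (b ^ n) (tensor_power a b L n)"
  unfolding tensor_stable_positive_def
proof (intro conjI allI impI)
  have L: "linear_map_mat a b L" using P by (simp add: tensor_stable_positive_def)
  show "linear_map_mat (a ^ n) (b ^ n) (tensor_power a b L n)" by (rule linear_map_mat_tensor_power)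
  fix m :: nat assume "m \<ge> 1"
  with n P have "positive_map (a ^ (m * n)) (b ^ (m * n)) (tensor_power a b L (m * n))"
    by (simp add: tensor_stable_positive_def)
  moreover have p: "(a ^ n) ^ m = a ^ (m * n)" "(b ^ n) ^ m = b ^ (m * n)"
    by (simp_all add: mult.commute flip: power_mult)
  ultimately show "positive_map ((a ^ n) ^ m) ((b ^ n) ^ m) (tensor_power (a ^ n) (b ^ n) (tensor_power a b L n) m)"
    using tensor_power_mult[OF L, of _ n m] by (auto intro: positive_map_cong)
qed

section \<open>Composition with maps that are completely positive and completely copositive\<close>

text \<open>For fixed \<open>r, s\<close> the difference of both sides is a kernel in the input indices whose quadratic
  form vanishes, because positive maps preserve Hermitian matrices. A positive kernel with zero
  diagonal is zero, which replaces polarization.\<close>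
lemma positive_map_choi_hermitian:
  assumes P: "positive_map a b L" and xy: "x \<in> rect a b" "y \<in> rect a b"
  shows "choi a L y x = cnj (choi a L x y)"
proof -
  obtain i r j s where x: "x = (i, r)" and y: "y = (j, s)" by (cases x; cases y) auto
  have ir: "i < a" "r < b" "j < a" "s < b" using xy by (auto simp: x y)
  have L: "linear_map_mat a b L" using P by (simp add: positive_map_def)
  let ?H = "\<lambda>l k. choi a L (k, r) (l, s) - cnj (choi a L (l, s) (k, r))"
  have q0: "quad_form {..<a} ?H f = 0" for f
  proof -
    \<comment> \<open>At this rank-one input the form of \<open>?H\<close> at \<open>f\<close> is
      the entry \<open>(r, s)\<close> of \<open>L X\<close> minus the conjugate of the entry
      \<open>(s, r)\<close>; positivity of \<open>L X\<close> makes it vanish.\<close>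
    define X where "X = mat a a (\<lambda>(k, l). f k * cnj (f l))"
    have Xc: "X \<in> carrier_mat a a" by (simp add: X_def)
    have "psd_kernel {..<a} (\<lambda>k l. X $$ (k, l))"
      using psd_kernel_rank_one[of "{..<a}" f] by (subst psd_kernel_cong) (auto simp: X_def)
    then have "psd b (L X)" using P Xc by (simp add: positive_map_def psd_iff_psd_kernel)
    then have "psd_kernel {..<b} (\<lambda>r s. L X $$ (r, s))" by (simp add: psd_iff_psd_kernel)
    from psd_kernel_hermitian[OF this, of s r] have h: "L X $$ (r, s) = cnj (L X $$ (s, r))"
      using ir by simp
    have 1: "L X $$ (r, s) = (\<Sum>l<a. \<Sum>k<a. cnj (f l) * choi a L (k, r) (l, s) * f k)"
      unfolding linear_map_mat_choi[OF L Xc ir(2,4)]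
      by (subst sum.swap) (simp add: X_def mult_ac)
    have 2: "cnj (L X $$ (s, r)) = (\<Sum>l<a. \<Sum>k<a. cnj (f l) * cnj (choi a L (l, s) (k, r)) * f k)"
      unfolding linear_map_mat_choi[OF L Xc ir(4,2)] by (simp add: X_def mult_ac)
    show ?thesis
      using h unfolding 1 2 by (simp add: quad_form_def left_diff_distrib right_diff_distrib sum_subtractf)
  qed
  then have psd: "psd_kernel {..<a} ?H" by (simp add: psd_kernel_def)
  have "?H k k = 0" if "k < a" for k
  proof -
    have "0 = quad_form {..<a} ?H (\<lambda>l. if l = k then 1 else 0)" by (simp only: q0)
    also have "\<dots> = quad_form {k} ?H (\<lambda>l. if l = k then 1 else 0)"
      using that by (intro quad_form_mono_neutral) auto
    finally show ?thesis by (simp add: quad_form_def)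
  qed
  from psd_kernel_zero_diag[OF psd _ _ _ this] ir
  have "?H j i = 0" by simp
  then have "cnj (choi a L (i, r) (j, s)) = cnj (cnj (choi a L (j, s) (i, r)))" by simp
  then show ?thesis by (simp add: x y)
qed

text \<open>The trace of the Choi kernel collects the diagonal entries of the images of the diagonal
  matrix units, which are positive.\<close>

lemma positive_map_trace_nonneg:
  assumes P: "positive_map a b L"
  shows "0 \<le> pairing (rect a b) (choi a L) id_kernel"
proof -
  have "pairing (rect a b) (choi a L) id_kernel = (\<Sum>x\<in>rect a b. \<Sum>y\<in>rect a b. if y = x then choi a L x y else 0)"
    unfolding pairing_def by (intro sum.cong refl) auto
  also have "\<dots> = (\<Sum>x\<in>rect a b. choi a L x x)" by simp
  also have "0 \<le> \<dots>"
  proof (rule sum_nonneg)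
    fix x assume x: "x \<in> rect a b"
    have "psd_kernel {..<a} (\<lambda>k l. of_bool (k = fst x) * cnj (of_bool (l = fst x)))"
      by (rule psd_kernel_rank_one)
    then have "psd_kernel {..<a} (\<lambda>k l. mat_unit a (fst x) (fst x) $$ (k, l))"
      by (subst psd_kernel_cong) (auto simp: mat_unit_index)
    then have "psd b (L (mat_unit a (fst x) (fst x)))"
      using P by (simp add: positive_map_def psd_iff_psd_kernel)
    then have "psd_kernel {..<b} (\<lambda>r s. L (mat_unit a (fst x) (fst x)) $$ (r, s))"
      by (simp add: psd_iff_psd_kernel)
    from psd_kernel_diag[OF this, of "snd x"] show "0 \<le> choi a L x x" using x by (auto simp: choi_def)
  qed
  finally show ?thesis .
qed

section \<open>Decomposable maps and their witnesses\<close>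

lemma linear_map_mat_transpose: "linear_map_mat a a transpose_mat"
  by (auto simp: linear_map_mat_def intro!: eq_matI)

lemma choi_comp_transpose: "choi a (L \<circ> transpose_mat) = partial_transpose (choi a L)"
proof -
  have "transpose_mat (mat_unit a i j) = mat_unit a j i" for i j
    by (intro eq_matI) (auto simp: mat_unit_def)
  then show ?thesis by (simp add: fun_eq_iff choi_def partial_transpose_def)
qed

text \<open>The two summands are paired separately: \<open>T1\<close> with \<open>\<rho>\<close>,
  and \<open>T2\<close>, after the transposition has been moved to the other side of the trace, with
  the transpose of the partial transpose of \<open>\<rho>\<close>. Each is a trace of two positive
  kernels.\<close>

lemma decomposable_pairing_nonneg:
  assumes D: "decomposable a b L"
    and R: "psd_kernel (rect a b) \<rho>" "psd_kernel (rect a b) (partial_transpose \<rho>)"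
  shows "0 \<le> pairing (rect a b) (choi a L) \<rho>"
proof -
  obtain T1 T2 where T: "completely_positive a b T1" "completely_positive a b T2"
    and eq: "\<And>X. X \<in> carrier_mat a a \<Longrightarrow> L X = T1 X + transpose_mat (T2 X)"
    using D unfolding decomposable_def by blast
  have c: "T1 (mat_unit a i j) \<in> carrier_mat b b" "T2 (mat_unit a i j) \<in> carrier_mat b b" for i j
    using T unfolding completely_positive_def by (blast intro: linear_map_mat_carrier mat_unit_carrier)+
  note d = carrier_matD[OF c(1)] carrier_matD[OF c(2)]
  \<comment> \<open>Transposing the output index is the same as transposing the input index and then
    the whole kernel.\<close>
  let ?C = "\<lambda>x y. partial_transpose (choi a T2) y x"
  have "pairing (rect a b) (choi a L) \<rho> = pairing (rect a b) (\<lambda>x y. choi a T1 x y + ?C x y) \<rho>"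
    by (rule pairing_cong) (auto simp: choi_def eq d partial_transpose_def)
  also have "\<dots> = pairing (rect a b) (choi a T1) \<rho> + pairing (rect a b) ?C \<rho>"
    by (rule pairing_add_left)
  also have "pairing (rect a b) ?C \<rho> = pairing (rect a b) (partial_transpose (choi a T2)) (\<lambda>x y. \<rho> y x)"
    unfolding pairing_def by (rule sum.swap)
  also have "\<dots> = pairing (rect a b) (choi a T2) (partial_transpose (\<lambda>x y. \<rho> y x))"
    using pairing_partial_transpose[of "{..<a}" "{..<b}" "choi a T2" "partial_transpose (\<lambda>x y. \<rho> y x)"]
    unfolding partial_transpose_twice .
  also have "partial_transpose (\<lambda>x y. \<rho> y x) = (\<lambda>x y. partial_transpose \<rho> y x)"
    by (simp add: partial_transpose_def fun_eq_iff)
  finally have "pairing (rect a b) (choi a L) \<rho> = pairing (rect a b) (choi a T1) \<rho>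
    + pairing (rect a b) (choi a T2) (\<lambda>x y. partial_transpose \<rho> y x)" .
  moreover have "0 \<le> pairing (rect a b) (choi a T1) \<rho>"
    by (rule pairing_nonneg[OF _ completely_positive_imp_psd_choi[OF T(1)] R(1)]) simp
  moreover have "0 \<le> pairing (rect a b) (choi a T2) (\<lambda>x y. partial_transpose \<rho> y x)"
    by (rule pairing_nonneg[OF _ completely_positive_imp_psd_choi[OF T(2)] psd_kernel_transpose[OF R(2)]]) simp
  ultimately show ?thesis by simp
qed

definition map_of_choi :: "nat \<Rightarrow> nat \<Rightarrow> (nat \<times> nat \<Rightarrow> nat \<times> nat \<Rightarrow> complex) \<Rightarrow> complex mat \<Rightarrow> complex mat" where
  "map_of_choi a b K X = mat b b (\<lambda>(r, s). \<Sum>i<a. \<Sum>j<a. X $$ (i, j) * K (i, r) (j, s))"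

lemma linear_map_of_choi: "linear_map_mat a b (map_of_choi a b K)"
  by (auto simp: linear_map_mat_def map_of_choi_def distrib_right sum.distrib sum_distrib_left mult.assoc
      intro!: eq_matI)

lemma choi_map_of_choi:
  assumes "x \<in> rect a b" "y \<in> rect a b"
  shows "choi a (map_of_choi a b K) x y = K x y"
proof -
  have "choi a (map_of_choi a b K) x y
      = (\<Sum>i<a. \<Sum>j<a. mat_unit a (fst x) (fst y) $$ (i, j) * K (i, snd x) (j, snd y))"
    using assms by (auto simp: choi_def map_of_choi_def)
  also have "\<dots> = (\<Sum>i<a. \<Sum>j<a. of_bool (i = fst x \<and> j = fst y) * K (i, snd x) (j, snd y))"
    by (intro sum.cong refl) (auto simp: mat_unit_index)
  also have "\<dots> = K x y" using assms by (subst sum_of_bool_two) auto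
  finally show ?thesis .
qed

text \<open>The map \<open>T\<close> with Choi matrix the flip of the transpose of \<open>\<rho>\<close> turns the pairing of \<open>L\<close> and \<open>\<rho>\<close>
  into the quadratic form of the Choi matrix of \<open>L \<circ> T\<close> at the maximally entangled vector.\<close>
lemma exists_ppt_map:
  assumes L: "linear_map_mat a b L"
    and R: "psd_kernel (rect a b) \<rho>" "psd_kernel (rect a b) (partial_transpose \<rho>)"
    and neg: "Re (pairing (rect a b) (choi a L) \<rho>) < 0"
  obtains T where "linear_map_mat b a T" "psd_kernel (rect b a) (choi b T)"
    "psd_kernel (rect b a) (partial_transpose (choi b T))" "\<not> psd_kernel (rect b b) (choi b (L \<circ> T))"
proof -
  define T where "T = map_of_choi b a (\<lambda>x y. \<rho> (prod.swap y) (prod.swap x))"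
  have T: "linear_map_mat b a T" by (simp add: T_def linear_map_of_choi)
  have choi_T: "choi b T x y = \<rho> (prod.swap y) (prod.swap x)"
    if "x \<in> rect b a" "y \<in> rect b a" for x y
    using that by (simp only: T_def choi_map_of_choi)
  have "psd_kernel (rect b a) (\<lambda>x y. \<rho> (prod.swap y) (prod.swap x))"
    by (rule psd_kernel_transpose, rule psd_kernel_pullback[OF _ R(1)]) auto
  then have 1: "psd_kernel (rect b a) (choi b T)"
    by (subst psd_kernel_cong[OF choi_T])
  \<comment> \<open>The input index of \<open>T\<close> is the output index of
    \<open>\<rho>\<close>. Transposing it on top of the full transposition in \<open>T\<close>
    leaves the transposition of the input index of \<open>\<rho>\<close>.\<close>
  have "psd_kernel (rect b a) (\<lambda>x y. partial_transpose \<rho> (prod.swap x) (prod.swap y))"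
    by (rule psd_kernel_pullback[OF _ R(2)]) auto
  then have 2: "psd_kernel (rect b a) (partial_transpose (choi b T))"
    by (subst psd_kernel_cong) (auto simp: partial_transpose_def choi_T)
  let ?\<omega> = "\<lambda>x. of_bool (fst x = snd x)"
  have "quad_form (rect b b) (choi b (L \<circ> T)) ?\<omega>
      = quad_form ((\<lambda>r. (r, r)) ` {..<b}) (choi b (L \<circ> T)) ?\<omega>"
    by (rule quad_form_mono_neutral) auto
  also have "\<dots> = quad_form ((\<lambda>r. (r, r)) ` {..<b}) (choi b (L \<circ> T)) (\<lambda>_. 1)"
    by (rule quad_form_cong) auto
  also have "\<dots> = (\<Sum>r<b. \<Sum>s<b. choi b (L \<circ> T) (r, r) (s, s))"
    by (simp add: quad_form_def sum.reindex inj_on_def)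
  also have "\<dots> = (\<Sum>r<b. \<Sum>s<b. \<Sum>i<a. \<Sum>j<a. choi a L (i, r) (j, s) * \<rho> (j, s) (i, r))"
  proof (intro sum.cong refl)
    fix r s assume "r \<in> {..<b}" "s \<in> {..<b}"
    then have rs: "r < b" "s < b" by auto
    have "choi b (L \<circ> T) (r, r) (s, s)
        = (\<Sum>i<a. \<Sum>j<a. T (mat_unit b r s) $$ (i, j) * choi a L (i, r) (j, s))"
      unfolding choi_def[of b] using linear_map_mat_choi[OF L linear_map_mat_carrier[OF T mat_unit_carrier] rs]
      by simp
    also have "\<dots> = (\<Sum>i<a. \<Sum>j<a. choi a L (i, r) (j, s) * \<rho> (j, s) (i, r))"
    proof (intro sum.cong refl)
      fix i j assume "i \<in> {..<a}" "j \<in> {..<a}"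
      then show "T (mat_unit b r s) $$ (i, j) * choi a L (i, r) (j, s) = choi a L (i, r) (j, s) * \<rho> (j, s) (i, r)"
        using choi_T[of "(r, i)" "(s, j)"] rs by (simp add: choi_def[of b])
    qed
    finally show "choi b (L \<circ> T) (r, r) (s, s) = (\<Sum>i<a. \<Sum>j<a. choi a L (i, r) (j, s) * \<rho> (j, s) (i, r))" .
  qed
  also have "\<dots> = (\<Sum>r<b. \<Sum>i<a. \<Sum>s<b. \<Sum>j<a. choi a L (i, r) (j, s) * \<rho> (j, s) (i, r))"
    by (intro sum.cong refl sum.swap)
  also have "\<dots> = (\<Sum>i<a. \<Sum>r<b. \<Sum>s<b. \<Sum>j<a. choi a L (i, r) (j, s) * \<rho> (j, s) (i, r))"
    by (rule sum.swap)
  also have "\<dots> = (\<Sum>i<a. \<Sum>r<b. \<Sum>j<a. \<Sum>s<b. choi a L (i, r) (j, s) * \<rho> (j, s) (i, r))"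
    by (intro sum.cong refl sum.swap)
  also have "\<dots> = pairing (rect a b) (choi a L) \<rho>"
    by (simp add: pairing_def sum.cartesian_product')
  finally have q: "Re (quad_form (rect b b) (choi b (L \<circ> T)) ?\<omega>) < 0" using neg by simp
  have 3: "\<not> psd_kernel (rect b b) (choi b (L \<circ> T))"
  proof
    assume "psd_kernel (rect b b) (choi b (L \<circ> T))"
    then have "0 \<le> quad_form (rect b b) (choi b (L \<circ> T)) ?\<omega>" unfolding psd_kernel_def by blast
    with q show False by (simp add: less_eq_complex_def)
  qed
  show thesis by (rule that[OF T 1 2 3])
qed

section \<open>Tensor-stable positive maps and the failure of the assertion\<close>

lemma tensor_stable_positive_imp_positive:
  assumes P: "tensor_stable_positive a b L"
  shows "positive_map a b L"
proof -
  have "positive_map a b (tensor_power a b L 1)"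
    using P unfolding tensor_stable_positive_def by (metis le_refl power_one_right)
  then show ?thesis
    by (rule positive_map_cong) (rule tensor_power_1, use P in \<open>simp_all add: tensor_stable_positive_def\<close>)
qed

text \<open>The witness construction is applied with the same map in both roles: failure of complete
  positivity supplies one negative vector, failure of complete copositivity the other. The exponent
  \<open>Suc k\<close> counts one factor for the second role and \<open>k\<close> for the
  first.\<close>

lemma tensor_stable_positive_ppt_factor:
  assumes P: "tensor_stable_positive a b L"
    and n: "\<not> completely_positive a b L" "\<not> completely_copositive a b L"
  obtains k T where "linear_map_mat (b ^ Suc k) (a ^ Suc k) T"
    "psd_kernel (rect (b ^ Suc k) (a ^ Suc k)) (choi (b ^ Suc k) T)"
    "psd_kernel (rect (b ^ Suc k) (a ^ Suc k)) (partial_transpose (choi (b ^ Suc k) T))"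
    "\<not> psd_kernel (rect (b ^ Suc k) (b ^ Suc k)) (choi (b ^ Suc k) (tensor_power a b L (Suc k) \<circ> T))"
proof -
  have L: "linear_map_mat a b L" using P by (simp add: tensor_stable_positive_def)
  note pos = tensor_stable_positive_imp_positive[OF P]
  note herm = positive_map_choi_hermitian[OF pos] and tr = positive_map_trace_nonneg[OF pos]
  have n1: "\<not> psd_kernel (rect a b) (choi a L)" using n(1) completely_positiveI[OF L] by blast
  have n2: "\<not> psd_kernel (rect a b) (partial_transpose (choi a L))"
    using n(2) completely_copositiveI[OF L] by blast
  obtain k \<rho> where \<rho>: "psd_kernel (rect (a * a ^ k) (b * b ^ k)) \<rho>"
      "psd_kernel (rect (a * a ^ k) (b * b ^ k)) (partial_transpose \<rho>)"
    and neg: "Re (pairing (rect (a * a ^ k) (b * b ^ k))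
        (tensor_kernel (a ^ k) (b ^ k) (choi a L) (kernel_power a b (choi a L) k)) \<rho>) < 0"
    using exists_ppt_witness[OF herm herm tr tr n1 n2] by blast
  have "Re (pairing (rect (a ^ Suc k) (b ^ Suc k)) (choi (a ^ Suc k) (tensor_power a b L (Suc k))) \<rho>) < 0"
    using neg by (subst pairing_cong[OF choi_tensor_power[OF L] refl]) simp_all
  then show thesis
    by (rule exists_ppt_map[OF linear_map_mat_tensor_power \<rho>[folded power_Suc]]) (rule that)
qed

theorem theorem6p3:
  assumes "\<exists>d d' P\<^sub>0. d \<ge> 1 \<and> d' \<ge> 1 \<and> tensor_stable_positive d d' P\<^sub>0 \<and>
             \<not> completely_positive d d' P\<^sub>0 \<and> \<not> completely_copositive d d' P\<^sub>0"
  shows "\<not> (\<forall>d\<^sub>1 d\<^sub>2 d\<^sub>3 T P. d\<^sub>1 \<ge> 1 \<longrightarrow> d\<^sub>2 \<ge> 1 \<longrightarrow> d\<^sub>3 \<ge> 1 \<longrightarrow>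
             completely_positive d\<^sub>1 d\<^sub>2 T \<longrightarrow> completely_copositive d\<^sub>1 d\<^sub>2 T \<longrightarrow>
             positive_map d\<^sub>2 d\<^sub>3 P \<longrightarrow> decomposable d\<^sub>1 d\<^sub>3 (P \<circ> T))"
proof
  assume conj: "\<forall>d\<^sub>1 d\<^sub>2 d\<^sub>3 T P. d\<^sub>1 \<ge> 1 \<longrightarrow> d\<^sub>2 \<ge> 1 \<longrightarrow> d\<^sub>3 \<ge> 1 \<longrightarrow>
             completely_positive d\<^sub>1 d\<^sub>2 T \<longrightarrow> completely_copositive d\<^sub>1 d\<^sub>2 T \<longrightarrow>
             positive_map d\<^sub>2 d\<^sub>3 P \<longrightarrow> decomposable d\<^sub>1 d\<^sub>3 (P \<circ> T)"
  obtain d d' P\<^sub>0 where d: "d \<ge> 1" "d' \<ge> 1" and P0: "tensor_stable_positive d d' P\<^sub>0"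
    and nt: "\<not> completely_positive d d' P\<^sub>0" "\<not> completely_copositive d d' P\<^sub>0"
    using assms by blast
  obtain n T where T_raw: "linear_map_mat (d' ^ Suc n) (d ^ Suc n) T"
      "psd_kernel (rect (d' ^ Suc n) (d ^ Suc n)) (choi (d' ^ Suc n) T)"
      "psd_kernel (rect (d' ^ Suc n) (d ^ Suc n)) (partial_transpose (choi (d' ^ Suc n) T))"
      "\<not> psd_kernel (rect (d' ^ Suc n) (d' ^ Suc n)) (choi (d' ^ Suc n) (tensor_power d d' P\<^sub>0 (Suc n) \<circ> T))"
    using tensor_stable_positive_ppt_factor[OF P0 nt] .
  define a b R where "a = d ^ Suc n" and "b = d' ^ Suc n" and "R = tensor_power d d' P\<^sub>0 (Suc n)"
  have ab: "a \<ge> 1" "b \<ge> 1" using d by (simp_all add: a_def b_def one_le_power del: power_Suc)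
  have R: "tensor_stable_positive a b R"
    unfolding a_def b_def R_def by (rule tensor_stable_positive_power[OF P0]) simp
  have Rl: "linear_map_mat a b R" using R by (simp add: tensor_stable_positive_def)
  note T = T_raw[folded a_def b_def R_def]
  \<comment> \<open>Both failures required for the second witness come from
    \<open>R \<circ> T\<close>: since the Choi kernel of \<open>R \<circ> ?U\<close> is the partial
    transpose of that of \<open>R \<circ> T\<close>, its own partial transpose is the kernel that is
    not positive.\<close>
  let ?U = "T \<circ> transpose_mat"
  have U: "linear_map_mat b a ?U" by (rule linear_map_mat_comp[OF linear_map_mat_transpose T(1)])
  have RT: "linear_map_mat b b (R \<circ> T)" by (rule linear_map_mat_comp[OF T(1) Rl])
  have RU: "linear_map_mat b b (R \<circ> ?U)" by (rule linear_map_mat_comp[OF U Rl])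
  have U_psd: "psd_kernel (rect b a) (choi b ?U)" "psd_kernel (rect b a) (partial_transpose (choi b ?U))"
    using T(2,3) by (simp_all add: choi_comp_transpose)
  note posR = tensor_stable_positive_imp_positive[OF R]
  \<comment> \<open>Positivity of both composites provides the Hermitian kernels and non-negative
    traces on which the witness construction rests.\<close>
  have pos: "positive_map b b (R \<circ> T)" "positive_map b b (R \<circ> ?U)"
    by (rule positive_map_comp[OF positive_mapI[OF T(1,2)] posR],
        rule positive_map_comp[OF positive_mapI[OF U U_psd(1)] posR])
  have choi_RU: "choi b (R \<circ> ?U) = partial_transpose (choi b (R \<circ> T))"
    by (simp only: comp_assoc[symmetric] choi_comp_transpose)
  have n2: "\<not> psd_kernel (rect b b) (partial_transpose (choi b (R \<circ> ?U)))"
    unfolding choi_RU partial_transpose_twice by (rule T(4))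
  obtain k \<rho> where \<rho>: "psd_kernel (rect (b * b ^ k) (b * b ^ k)) \<rho>"
      "psd_kernel (rect (b * b ^ k) (b * b ^ k)) (partial_transpose \<rho>)"
    and neg: "Re (pairing (rect (b * b ^ k) (b * b ^ k))
        (tensor_kernel (b ^ k) (b ^ k) (choi b (R \<circ> ?U)) (kernel_power b b (choi b (R \<circ> T)) k)) \<rho>) < 0"
    using exists_ppt_witness[OF positive_map_choi_hermitian[OF pos(1)] positive_map_choi_hermitian[OF pos(2)]
        positive_map_trace_nonneg[OF pos(1)] positive_map_trace_nonneg[OF pos(2)] T(4) n2] by blast
  \<comment> \<open>\<open>P\<close> is a pure power of \<open>R\<close>, so tensor stability makes
    it positive, while the mixture of \<open>?U\<close> and \<open>T\<close> sits in
    \<open>S\<close>. By design the composition is the product of \<open>R \<circ> ?U\<close> with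
    \<open>k\<close> copies of \<open>R \<circ> T\<close>.\<close>
  define P where "P = tensor_power a b R (Suc k)"
  define S where "S = tensor_map b a (b ^ k) (a ^ k) ?U (tensor_power b a T k)"
  have S: "linear_map_mat (b * b ^ k) (a * a ^ k) S" by (simp add: S_def linear_map_mat_tensor_map)
  have cp: "completely_positive (b * b ^ k) (a * a ^ k) S"
    using psd_choi_tensor_map(1)[OF U linear_map_mat_tensor_power U_psd(1) psd_choi_tensor_power(1)[OF T(1,2)]]
    by (intro completely_positiveI S) (simp add: S_def)
  have ccp: "completely_copositive (b * b ^ k) (a * a ^ k) S"
    using psd_choi_tensor_map(2)[OF U linear_map_mat_tensor_power U_psd(2) psd_choi_tensor_power(2)[OF T(1,3)]]
    by (intro completely_copositiveI S) (simp add: S_def)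
  have "positive_map (a ^ Suc k) (b ^ Suc k) P"
    unfolding P_def using R unfolding tensor_stable_positive_def by (metis le_add1 plus_1_eq_Suc)
  then have posP: "positive_map (a * a ^ k) (b * b ^ k) P" by simp
  have "decomposable (b * b ^ k) (b * b ^ k) (P \<circ> S)"
    by (rule conj[rule_format, OF _ _ _ cp ccp posP]) (use ab in \<open>simp_all add: Suc_le_eq\<close>)
  from decomposable_pairing_nonneg[OF this \<rho>]
  have nonneg: "0 \<le> pairing (rect (b * b ^ k) (b * b ^ k)) (choi (b * b ^ k) (P \<circ> S)) \<rho>" .
  \<comment> \<open>This identifies the Choi kernel of \<open>P \<circ> S\<close> with the one on
    which \<open>\<rho>\<close> is negative, against the non-negativity forced by
    decomposability.\<close>
  have "choi (b * b ^ k) (P \<circ> S) x y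
      = tensor_kernel (b ^ k) (b ^ k) (choi b (R \<circ> ?U)) (kernel_power b b (choi b (R \<circ> T)) k) x y"
    if xy: "x \<in> rect (b * b ^ k) (b * b ^ k)" "y \<in> rect (b * b ^ k) (b * b ^ k)" for x y
  proof -
    have "P (S X) = tensor_map b b (b ^ k) (b ^ k) (R \<circ> ?U) (tensor_power b b (R \<circ> T) k) X"
      if "X \<in> carrier_mat (b * b ^ k) (b * b ^ k)" for X
    proof -
      have "P (S X) = tensor_map b b (b ^ k) (b ^ k) (R \<circ> ?U) (tensor_power a b R k \<circ> tensor_power b a T k) X"
        unfolding P_def S_def tensor_power.simps
        by (rule tensor_map_comp[OF U linear_map_mat_tensor_power Rl linear_map_mat_tensor_power that])
      also have "\<dots> = tensor_map b b (b ^ k) (b ^ k) (R \<circ> ?U) (tensor_power b b (R \<circ> T) k) X"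
        by (intro tensor_map_cong refl, subst comp_apply) (rule tensor_power_comp[OF T(1) Rl])
      finally show ?thesis .
    qed
    then have "choi (b * b ^ k) (P \<circ> S) x y
        = choi (b * b ^ k) (tensor_map b b (b ^ k) (b ^ k) (R \<circ> ?U) (tensor_power b b (R \<circ> T) k)) x y"
      unfolding choi_def by (simp only: comp_apply mat_unit_carrier)
    also have "\<dots> = tensor_kernel (b ^ k) (b ^ k) (choi b (R \<circ> ?U)) (choi (b ^ k) (tensor_power b b (R \<circ> T) k)) x y"
      by (rule choi_tensor_map[OF RU linear_map_mat_tensor_power xy])
    also have "\<dots> = tensor_kernel (b ^ k) (b ^ k) (choi b (R \<circ> ?U)) (kernel_power b b (choi b (R \<circ> T)) k) x y"
      by (rule tensor_kernel_cong[OF refl choi_tensor_power[OF RT] xy])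
    finally show ?thesis .
  qed
  then have "pairing (rect (b * b ^ k) (b * b ^ k)) (choi (b * b ^ k) (P \<circ> S)) \<rho> =
    pairing (rect (b * b ^ k) (b * b ^ k))
      (tensor_kernel (b ^ k) (b ^ k) (choi b (R \<circ> ?U)) (kernel_power b b (choi b (R \<circ> T)) k)) \<rho>"
    by (rule pairing_cong) simp_all
  with nonneg neg show False by (simp add: less_eq_complex_def)
qed

end
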